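(* The map $\mathsf{S}:\mathbf{P}\to\mathbf{K}$, sending a regular prime $\omega$-poset $\mathbb{P}$ to its spectrum $\mathsf{S}\mathbb{P}$ and a $\wedge$-preserving refiner $\rho\subseteq\mathbb{Q}\times\mathbb{P}$ to the continuous map $\mathsf{S}(\rho)=\phi_\rho:\mathsf{S}\mathbb{P}\to\mathsf{S}\mathbb{Q}$, is an essentially surjective full functor.
   Context: Let $(\mathbb{P},\leq)$ be a poset. A subset $S\subseteq\mathbb{P}$ refines $T\subseteq\mathbb{P}$ if for every $s\in S$ there is $t\in T$ with $s\leq t$. A band of $\mathbb{P}$ is a finite subset $B\subseteq\mathbb{P}$ such that every $p\in\mathbb{P}$ is comparable to some $b\in B$. A cap of $\mathbb{P}$ is a subset refined by some band. A selector is a subset $S\subseteq\mathbb{P}$ with $S\cap C\neq\emptyset$ for every cap $C$ of $\mathbb{P}$; a minimal selector is one minimal with respect to inclusion among all selectors. The spectrum $\mathsf{S}\mathbb{P}$ is the set of all minimal selectors, with the topology generated by the subbasis consisting of the sets $p^\in=\{S\in\mathsf{S}\mathbb{P}:p\in S\}$, for $p\in\mathbb{P}$. $\mathbb{P}$ is an $\omega$-poset if every principal filter $p^\leq=\{q\in\mathbb{P}:p\leq q\}$ is finite and, for each $n\in\omega$, the number of principal filters of size $n$ is finite. $\mathbb{P}$ is prime if every element of $\mathbb{P}$ lies in some minimal selector. For $p,q\in\mathbb{P}$ write $p\wedge q$ if there is $r\in\mathbb{P}$ with $r\leq p$ and $r\leq q$. For $p\in\mathbb{P}$ and a cap $C$,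 the star of $p$ in $C$ is $Cp=\{c\in C:c\wedge p\}$. Write $p\vartriangleleft q$ if there is a cap $C$ of $\mathbb{P}$ such that $c\leq q$ for all $c\in Cp$. The poset $\mathbb{P}$ is regular if for every cap $D$ of $\mathbb{P}$ there is a cap $C$ of $\mathbb{P}$ such that for each $c\in C$ there is $d\in D$ with $c\vartriangleleft d$. A relation $\rho\subseteq\mathbb{Q}\times\mathbb{P}$ between posets is a refiner if for every cap $D$ of $\mathbb{Q}$ there is a cap $C$ of $\mathbb{P}$ such that for every $c\in C$ there is $d\in D$ with $d\,\rho\,c$. It is $\wedge$-preserving if, for all $p,p'\in\mathbb{P}$ and $q,q'\in\mathbb{Q}$, $q\,\rho\,p$, $q'\,\rho\,p'$ and $p\wedge p'$ imply $q\wedge q'$. $\mathbf{K}$ is the category of metrisable compact spaces and continuous maps. $\mathbf{P}$ is the category whose objects are regular prime $\omega$-posets and whose morphisms from $\mathbb{P}$ to $\mathbb{Q}$ are the $\wedge$-preserving refiners $\rho\subseteq\mathbb{Q}\times\mathbb{P}$, with the usual composition of relations $\sigma\circ\rho=\{(r,p):\exists q\ (r\,\sigma\,q\text{ and }q\,\rho\,p)\}$ and identities the equality relations $\mathrm{id}_{\mathbb{P}}$. For such $\rho$, the (well-defined, continuous) map $\phi_\rho:\mathsf{S}\mathbb{P}\to\mathsf{S}\mathbb{Q}$ is given by \[\phi_\rho(S)=\{q\in\mathbb{Q}:\exists p\in S\ \exists q'\in\mathbb{Q}\ (q'\,\rho\,p\text{ and }q'\vartriangleleft q)\}.\] *)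

theory Defs
  imports "HOL-Analysis.Analysis"
begin

section \<open>Categories and functors\<close>

text \<open>
  Categories are given by hom-sets: a morphism need not determine its source and target, so
  composition takes the three objects as arguments, and \<open>Comp C X Y Z g f\<close> is \<open>g \<circ> f\<close>
  for \<open>f : X \<rightarrow> Y\<close> and \<open>g : Y \<rightarrow> Z\<close>.
\<close>

record ('o, 'm) category =
  Obj  :: "'o set"
  Hom  :: "'o \<Rightarrow> 'o \<Rightarrow> 'm set"
  Idm  :: "'o \<Rightarrow> 'm"
  Comp :: "'o \<Rightarrow> 'o \<Rightarrow> 'o \<Rightarrow> 'm \<Rightarrow> 'm \<Rightarrow> 'm"

definition is_category :: "('o, 'm) category \<Rightarrow> bool" where
  "is_category C \<longleftrightarrow>
     (\<forall>X\<in>Obj C. Idm C X \<in> Hom C X X) \<and>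
     (\<forall>X\<in>Obj C. \<forall>Y\<in>Obj C. \<forall>Z\<in>Obj C. \<forall>f\<in>Hom C X Y. \<forall>g\<in>Hom C Y Z.
        Comp C X Y Z g f \<in> Hom C X Z) \<and>
     (\<forall>X\<in>Obj C. \<forall>Y\<in>Obj C. \<forall>f\<in>Hom C X Y.
        Comp C X X Y f (Idm C X) = f \<and> Comp C X Y Y (Idm C Y) f = f) \<and>
     (\<forall>W\<in>Obj C. \<forall>X\<in>Obj C. \<forall>Y\<in>Obj C. \<forall>Z\<in>Obj C.
        \<forall>f\<in>Hom C W X. \<forall>g\<in>Hom C X Y. \<forall>h\<in>Hom C Y Z.
        Comp C W Y Z h (Comp C W X Y g f) = Comp C W X Z (Comp C X Y Z h g) f)"

definition isomorphic_objects :: "('o, 'm) category \<Rightarrow> 'o \<Rightarrow> 'o \<Rightarrow> bool" where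
  "isomorphic_objects C X Y \<longleftrightarrow>
     (\<exists>f\<in>Hom C X Y. \<exists>g\<in>Hom C Y X. Comp C X Y X g f = Idm C X \<and> Comp C Y X Y f g = Idm C Y)"

definition is_functor ::
  "('o, 'm) category \<Rightarrow> ('a, 'b) category \<Rightarrow> ('o \<Rightarrow> 'a) \<Rightarrow> ('o \<Rightarrow> 'o \<Rightarrow> 'm \<Rightarrow> 'b) \<Rightarrow> bool" where
  "is_functor C D F Fm \<longleftrightarrow>
     is_category C \<and> is_category D \<and>
     (\<forall>X\<in>Obj C. F X \<in> Obj D) \<and>
     (\<forall>X\<in>Obj C. \<forall>Y\<in>Obj C. \<forall>f\<in>Hom C X Y. Fm X Y f \<in> Hom D (F X) (F Y)) \<and>
     (\<forall>X\<in>Obj C. Fm X X (Idm C X) = Idm D (F X)) \<and>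
     (\<forall>X\<in>Obj C. \<forall>Y\<in>Obj C. \<forall>Z\<in>Obj C. \<forall>f\<in>Hom C X Y. \<forall>g\<in>Hom C Y Z.
        Fm X Z (Comp C X Y Z g f) = Comp D (F X) (F Y) (F Z) (Fm Y Z g) (Fm X Y f))"

definition full_functor ::
  "('o, 'm) category \<Rightarrow> ('a, 'b) category \<Rightarrow> ('o \<Rightarrow> 'a) \<Rightarrow> ('o \<Rightarrow> 'o \<Rightarrow> 'm \<Rightarrow> 'b) \<Rightarrow> bool" where
  "full_functor C D F Fm \<longleftrightarrow>
     is_functor C D F Fm \<and>
     (\<forall>X\<in>Obj C. \<forall>Y\<in>Obj C. \<forall>h\<in>Hom D (F X) (F Y). \<exists>f\<in>Hom C X Y. Fm X Y f = h)"

definition essentially_surjective_functor ::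
  "('o, 'm) category \<Rightarrow> ('a, 'b) category \<Rightarrow> ('o \<Rightarrow> 'a) \<Rightarrow> ('o \<Rightarrow> 'o \<Rightarrow> 'm \<Rightarrow> 'b) \<Rightarrow> bool" where
  "essentially_surjective_functor C D F Fm \<longleftrightarrow>
     is_functor C D F Fm \<and>
     (\<forall>Z\<in>Obj D. \<exists>X\<in>Obj C. isomorphic_objects D (F X) Z)"


section \<open>Posets and their spectra\<close>

text \<open>
  A poset is a relation \<open>P\<close> with \<open>Partial_order P\<close>; its underlying set is \<open>Field P\<close>, and
  \<open>(p, q) \<in> P\<close> means \<open>p \<le> q\<close>. Nothing is lost, since \<open>\<le>\<close> is reflexive. The poset may be empty.
\<close>

definition refines :: "'a rel \<Rightarrow> 'a set \<Rightarrow> 'a set \<Rightarrow> bool" where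
  "refines P S T \<longleftrightarrow> (\<forall>s\<in>S. \<exists>t\<in>T. (s, t) \<in> P)"

definition band :: "'a rel \<Rightarrow> 'a set \<Rightarrow> bool" where
  "band P B \<longleftrightarrow> finite B \<and> B \<subseteq> Field P \<and> (\<forall>p\<in>Field P. \<exists>b\<in>B. (p, b) \<in> P \<or> (b, p) \<in> P)"

definition cap :: "'a rel \<Rightarrow> 'a set \<Rightarrow> bool" where
  "cap P C \<longleftrightarrow> C \<subseteq> Field P \<and> (\<exists>B. band P B \<and> refines P B C)"

definition selector :: "'a rel \<Rightarrow> 'a set \<Rightarrow> bool" where
  "selector P S \<longleftrightarrow> S \<subseteq> Field P \<and> (\<forall>C. cap P C \<longrightarrow> S \<inter> C \<noteq> {})"

definition minimal_selector :: "'a rel \<Rightarrow> 'a set \<Rightarrow> bool" where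
  "minimal_selector P S \<longleftrightarrow> selector P S \<and> (\<forall>T. selector P T \<and> T \<subseteq> S \<longrightarrow> T = S)"

definition spectrum_set :: "'a rel \<Rightarrow> 'a set set" where
  "spectrum_set P = {S. minimal_selector P S}"

definition elem_set :: "'a rel \<Rightarrow> 'a \<Rightarrow> 'a set set" where
  "elem_set P p = {S \<in> spectrum_set P. p \<in> S}"

text \<open>
  The whole spectrum is added to the subbasis because it is the empty intersection of subbasic
  sets, which \<open>topology_generated_by\<close> does not include by itself.
\<close>

definition spectrum :: "'a rel \<Rightarrow> 'a set topology" where
  "spectrum P = topology_generated_by (insert (spectrum_set P) (elem_set P ` Field P))"

definition omega_poset :: "'a rel \<Rightarrow> bool" where
  "omega_poset P \<longleftrightarrow>
     Partial_order P \<and>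
     (\<forall>p\<in>Field P. finite (above P p)) \<and>
     (\<forall>n. finite {F \<in> above P ` Field P. card F = n})"

definition prime_poset :: "'a rel \<Rightarrow> bool" where
  "prime_poset P \<longleftrightarrow> (\<forall>p\<in>Field P. \<exists>S. minimal_selector P S \<and> p \<in> S)"

definition wedge :: "'a rel \<Rightarrow> 'a \<Rightarrow> 'a \<Rightarrow> bool" where
  "wedge P p q \<longleftrightarrow> (\<exists>r\<in>Field P. (r, p) \<in> P \<and> (r, q) \<in> P)"

definition star_in :: "'a rel \<Rightarrow> 'a set \<Rightarrow> 'a \<Rightarrow> 'a set" where
  "star_in P C p = {c \<in> C. wedge P c p}"

definition star_below :: "'a rel \<Rightarrow> 'a \<Rightarrow> 'a \<Rightarrow> bool" where
  "star_below P p q \<longleftrightarrow>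
     p \<in> Field P \<and> q \<in> Field P \<and> (\<exists>C. cap P C \<and> (\<forall>c\<in>star_in P C p. (c, q) \<in> P))"

definition regular_poset :: "'a rel \<Rightarrow> bool" where
  "regular_poset P \<longleftrightarrow>
     (\<forall>D. cap P D \<longrightarrow> (\<exists>C. cap P C \<and> (\<forall>c\<in>C. \<exists>d\<in>D. star_below P c d)))"


section \<open>Refiners and the spectrum functor\<close>

text \<open>
  A relation \<open>\<rho> \<subseteq> Field Q \<times> Field P\<close> is a morphism from \<open>P\<close> to \<open>Q\<close>: in the definitions below the source
  \<open>P\<close> is the first poset argument, but its elements are the second components of \<open>\<rho>\<close>.
\<close>

definition refiner :: "'p rel \<Rightarrow> 'q rel \<Rightarrow> ('q \<times> 'p) set \<Rightarrow> bool" where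
  "refiner P Q \<rho> \<longleftrightarrow>
     \<rho> \<subseteq> Field Q \<times> Field P \<and>
     (\<forall>D. cap Q D \<longrightarrow> (\<exists>C. cap P C \<and> (\<forall>c\<in>C. \<exists>d\<in>D. (d, c) \<in> \<rho>)))"

definition wedge_preserving :: "'p rel \<Rightarrow> 'q rel \<Rightarrow> ('q \<times> 'p) set \<Rightarrow> bool" where
  "wedge_preserving P Q \<rho> \<longleftrightarrow>
     (\<forall>p\<in>Field P. \<forall>p'\<in>Field P. \<forall>q\<in>Field Q. \<forall>q'\<in>Field Q.
        (q, p) \<in> \<rho> \<and> (q', p') \<in> \<rho> \<and> wedge P p p' \<longrightarrow> wedge Q q q')"

definition spectrum_map :: "'p rel \<Rightarrow> 'q rel \<Rightarrow> ('q \<times> 'p) set \<Rightarrow> 'p set \<Rightarrow> 'q set" where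
  "spectrum_map P Q \<rho> =
     (\<lambda>S\<in>spectrum_set P.
        {q \<in> Field Q. \<exists>p\<in>S. \<exists>q'\<in>Field Q. (q', p) \<in> \<rho> \<and> star_below Q q' q})"

text \<open>Relational composition \<open>O\<close> is in the order of the usual \<open>\<sigma> \<circ> \<rho>\<close>, as \<open>\<sigma>\<close> relates
  elements of the final target to elements of the intermediate poset.\<close>

text \<open>The objects are the posets with underlying set contained in \<open>'a\<close>. As \<open>\<omega>\<close>-posets are
  countable, every one is isomorphic to an object as soon as \<open>'a\<close> is infinite.\<close>

definition poset_category :: "('a rel, 'a rel) category" where
  "poset_category =
     \<lparr> Obj = {P. omega_poset P \<and> prime_poset P \<and> regular_poset P},
       Hom = (\<lambda>P Q. {\<rho>. refiner P Q \<rho> \<and> wedge_preserving P Q \<rho>}),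
       Idm = (\<lambda>P. Id_on (Field P)),
       Comp = (\<lambda>P Q R \<sigma> \<rho>. \<sigma> O \<rho>) \<rparr>"

text \<open>Continuous maps are taken extensional (\<open>undefined\<close> off the source space), so that equality
  of morphisms is equality of maps on the space.\<close>

definition compact_metrizable_category :: "('x topology, 'x \<Rightarrow> 'x) category" where
  "compact_metrizable_category =
     \<lparr> Obj = {X. compact_space X \<and> metrizable_space X},
       Hom = (\<lambda>X Y. {f. continuous_map X Y f \<and> f \<in> extensional (topspace X)}),
       Idm = (\<lambda>X. \<lambda>x\<in>topspace X. x),
       Comp = (\<lambda>X Y Z g f. compose (topspace X) g f) \<rparr>"

end

theory Submission
  imports Defs
begin

text \<open>
  In an \<open>\<omega>\<close>-poset any two caps have a common refinement by a band
  (\<open>caps_common_refinement\<close>). It follows that a minimal selector is an up-closed filter, so the sets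
  \<open>elem_set P p\<close> form a base of the spectrum. A Zorn argument puts a minimal selector inside every
  selector, and this makes caps correspond to covers: a set of elements that meets every minimal selector
  is a cap. Compactness is then the existence of finite subcaps. In a prime poset, \<open>p \<triangleleft> q\<close> forces the
  closure of \<open>elem_set P p\<close> into \<open>elem_set P q\<close>, and regularity gives, for every element \<open>q\<close> of a
  minimal selector, some \<open>p \<triangleleft> q\<close> in the same selector. This yields the Hausdorff property and, by
  Urysohn functions for the countably many pairs \<open>p \<triangleleft> q\<close>, metrisability.

  For a \<open>\<and>\<close>-preserving refiner \<open>\<rho>\<close> and a minimal selector \<open>S\<close>, the image of \<open>S\<close> under \<open>\<rho>\<close> is a
  selector any two elements of which have a common lower bound. Such a selector contains exactly one
  minimal selector, and that one is \<open>\<phi>\<^sub>\<rho>(S)\<close> (\<open>spectrum_map_eqI\<close>). Functoriality and fullness are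
  immediate from this description. For composition, \<open>\<phi>\<^sub>\<sigma>(\<phi>\<^sub>\<rho>(S))\<close> is a minimal selector inside the image
  of \<open>S\<close> under \<open>\<sigma> \<circ> \<rho>\<close>. For fullness, a continuous map \<open>h\<close> is induced by the relation \<open>q \<rho> p\<close> saying
  that \<open>h\<close> maps \<open>elem_set P p\<close> into \<open>elem_set Q q\<close>: the image of \<open>S\<close> lies in the minimal selector
  \<open>h S\<close>.

  For essential surjectivity, take a finite \<open>2\<^sup>-\<^sup>n/2\<close>-net in the given compact metric space for each \<open>n\<close>
  and consider the balls of radius \<open>2\<^sup>-\<^sup>n\<close> around its points. They are ordered as formal balls:
  \<open>B(x, r) < B(y, s)\<close> when \<open>d(x, y) + r < s\<close>. Each layer is a band, every cap is refined by some layer, and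
  the minimal selectors are exactly the sets of all balls containing a given point.
\<close>

section \<open>Selectors and caps\<close>

lemma selector_subset_Field: "selector P S \<Longrightarrow> S \<subseteq> Field P"
  by (simp add: selector_def)

lemma selector_meets_cap: "selector P S \<Longrightarrow> cap P C \<Longrightarrow> \<exists>c\<in>C. c \<in> S"
  unfolding selector_def by blast

lemma minimal_selector_selector: "minimal_selector P S \<Longrightarrow> selector P S"
  by (simp add: minimal_selector_def)

lemma minimal_selector_eqI:
  "minimal_selector P S \<Longrightarrow> selector P T \<Longrightarrow> T \<subseteq> S \<Longrightarrow> T = S"
  by (simp add: minimal_selector_def)

lemma cap_subset_Field: "cap P C \<Longrightarrow> C \<subseteq> Field P"
  by (simp add: cap_def)

lemma cap_mono: "cap P C \<Longrightarrow> C \<subseteq> D \<Longrightarrow> D \<subseteq> Field P \<Longrightarrow> cap P D"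
  unfolding cap_def refines_def by (meson subset_iff)

lemma finite_subcap:
  assumes "cap P C"
  obtains D where "D \<subseteq> C" "finite D" "cap P D"
proof -
  obtain B where B: "band P B" "refines P B C" and C: "C \<subseteq> Field P"
    using assms by (auto simp: cap_def)
  then obtain f where f: "\<And>b. b \<in> B \<Longrightarrow> f b \<in> C \<and> (b, f b) \<in> P"
    unfolding refines_def by metis
  have "cap P (f ` B)"
    unfolding cap_def using B(1) C f by (auto simp: refines_def intro!: exI[of _ B])
  moreover have "finite (f ` B)" using B(1) by (simp add: band_def)
  ultimately show ?thesis using that[of "f ` B"] f by auto
qed

text \<open>
  By minimality, dropping \<open>p\<close> from \<open>S\<close> must lose a cap. This witness is how minimality is used in most of
  the arguments about single elements of \<open>S\<close>.
\<close>

lemma minimal_selector_cap_singleton: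
  assumes S: "minimal_selector P S" and p: "p \<in> S"
  obtains C where "cap P C" "S \<inter> C = {p}"
proof -
  have "\<not> selector P (S - {p})"
    using minimal_selector_eqI[OF S, of "S - {p}"] p by blast
  then obtain C where C: "cap P C" "(S - {p}) \<inter> C = {}"
    using S unfolding selector_def minimal_selector_def by blast
  then have "S \<inter> C = {p}"
    using selector_meets_cap[OF minimal_selector_selector[OF S], of C] by blast
  with C show ?thesis using that by blast
qed

text \<open>
  Meeting every cap is the same as meeting every finite cap, and a finite cap missed by the intersection
  of a chain is already missed by one member of the chain.
\<close>

lemma selector_Inter_chain:
  assumes "\<And>S. S \<in> \<C> \<Longrightarrow> selector P S" "\<C> \<noteq> {}"
    and chain: "\<And>S T. S \<in> \<C> \<Longrightarrow> T \<in> \<C> \<Longrightarrow> S \<subseteq> T \<or> T \<subseteq> S"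
  shows "selector P (\<Inter>\<C>)"
  unfolding selector_def
proof (intro conjI allI impI)
  show "\<Inter>\<C> \<subseteq> Field P" using assms(1,2) selector_subset_Field by fastforce
  fix C assume "cap P C"
  then obtain D where D: "D \<subseteq> C" "finite D" "cap P D" by (rule finite_subcap)
  show "\<Inter>\<C> \<inter> C \<noteq> {}"
  proof
    assume empty: "\<Inter>\<C> \<inter> C = {}"
    then have "\<forall>d\<in>D. \<exists>S\<in>\<C>. d \<notin> S" using D(1) by blast
    then obtain f where f: "\<And>d. d \<in> D \<Longrightarrow> f d \<in> \<C> \<and> d \<notin> f d" by metis
    have "\<exists>T\<in>\<C>. \<forall>d\<in>E. d \<notin> T" if "E \<subseteq> D" for E
      using finite_subset[OF that D(2)] that
    proof (induction E rule: finite_induct)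
      case empty
      then show ?case using assms(2) by blast
    next
      case (insert e E)
      then obtain T where T: "T \<in> \<C>" "\<forall>d\<in>E. d \<notin> T" by auto
      have e: "f e \<in> \<C>" "e \<notin> f e" using f insert.prems by auto
      from chain[OF T(1) e(1)] show ?case using T e by blast
    qed
    from this[of D] obtain T where "T \<in> \<C>" "\<forall>d\<in>D. d \<notin> T" by blast
    with selector_meets_cap[OF assms(1) D(3)] show False by blast
  qed
qed

text \<open>
  Zorn's lemma applied to the complements of the selectors inside \<open>S\<close>, since a maximal complement
  belongs to a minimal selector.
\<close>

lemma selector_contains_minimal:
  assumes "selector P S"
  obtains M where "minimal_selector P M" "M \<subseteq> S"
proof -
  define \<A> where "\<A> = {T. selector P T \<and> T \<subseteq> S}"
  have "\<exists>M\<in>\<A>. \<forall>T\<in>\<A>. T \<subseteq> M \<longrightarrow> T = M"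
  proof -
    define \<B> where "\<B> = uminus ` \<A>"
    have "\<exists>M\<in>\<B>. \<forall>T\<in>\<B>. M \<subseteq> T \<longrightarrow> T = M"
    proof (rule subset_Zorn_nonempty)
      show "\<B> \<noteq> {}" using assms by (auto simp: \<B>_def \<A>_def)
      fix \<C> assume ne: "\<C> \<noteq> {}" and ch: "subset.chain \<B> \<C>"
      have sub: "uminus ` \<C> \<subseteq> \<A>"
        using ch by (auto simp: subset.chain_def \<B>_def)
      have "selector P (\<Inter>(uminus ` \<C>))"
      proof (rule selector_Inter_chain)
        show "selector P T" if "T \<in> uminus ` \<C>" for T
          using sub that by (auto simp: \<A>_def)
        show "uminus ` \<C> \<noteq> {}" using ne by simp
        show "X \<subseteq> Y \<or> Y \<subseteq> X" if "X \<in> uminus ` \<C>" "Y \<in> uminus ` \<C>" for X Y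
        proof -
          obtain A B where "X = - A" "Y = - B" "A \<in> \<C>" "B \<in> \<C>" using \<open>X \<in> _\<close> \<open>Y \<in> _\<close> by blast
          then show ?thesis using ch unfolding subset_chain_def by (metis Compl_subset_Compl_iff)
        qed
      qed
      moreover have "\<Inter>(uminus ` \<C>) \<subseteq> S"
      proof -
        obtain X where "X \<in> \<C>" using ne by blast
        then have "- X \<subseteq> S" using sub by (auto simp: \<A>_def)
        then show ?thesis using \<open>X \<in> \<C>\<close> by blast
      qed
      ultimately have "\<Inter>(uminus ` \<C>) \<in> \<A>" by (simp add: \<A>_def)
      moreover have "\<Union>\<C> = - (\<Inter>(uminus ` \<C>))" by auto
      ultimately show "\<Union>\<C> \<in> \<B>" unfolding \<B>_def by (rule rev_image_eqI)
    qed
    then obtain N where N: "N \<in> \<A>" "\<And>T. T \<in> \<B> \<Longrightarrow> - N \<subseteq> T \<Longrightarrow> T = - N"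
      unfolding \<B>_def by auto
    have "T = N" if "T \<in> \<A>" "T \<subseteq> N" for T
      using N(2)[of "- T"] that by (auto simp: \<B>_def)
    with N(1) show ?thesis by blast
  qed
  then obtain M where M: "M \<in> \<A>" "\<And>T. T \<in> \<A> \<Longrightarrow> T \<subseteq> M \<Longrightarrow> T = M" by blast
  then have "minimal_selector P M" unfolding minimal_selector_def \<A>_def by auto
  with M(1) show ?thesis using that by (auto simp: \<A>_def)
qed

text \<open>
  If \<open>A\<close> is not a cap, then it contains no cap. So its complement is a selector, and a minimal selector
  inside that complement misses \<open>A\<close>. This is the bridge from covers of the spectrum to caps.
\<close>

lemma cap_if_meets_minimal_selectors:
  assumes "A \<subseteq> Field P" and meets: "\<And>S. minimal_selector P S \<Longrightarrow> S \<inter> A \<noteq> {}"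
  shows "cap P A"
proof (rule ccontr)
  assume "\<not> cap P A"
  then have "\<not> C \<subseteq> A" if "cap P C" for C
    using cap_mono that assms(1) by blast
  then have "selector P (Field P - A)"
    unfolding selector_def using cap_subset_Field by fastforce
  then obtain M where "minimal_selector P M" "M \<subseteq> Field P - A"
    by (rule selector_contains_minimal)
  with meets show False by blast
qed

section \<open>The spectrum of an omega-poset\<close>

lemma topspace_spectrum [simp]: "topspace (spectrum P) = spectrum_set P"
  unfolding spectrum_def by (auto simp: elem_set_def)

lemma openin_elem_set: "p \<in> Field P \<Longrightarrow> openin (spectrum P) (elem_set P p)"
  unfolding spectrum_def by (intro topology_generated_by_Basis) auto

lemma mem_spectrum_set: "S \<in> spectrum_set P \<longleftrightarrow> minimal_selector P S"
  by (simp add: spectrum_set_def)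

lemma mem_elem_set: "S \<in> elem_set P p \<longleftrightarrow> minimal_selector P S \<and> p \<in> S"
  by (simp add: elem_set_def spectrum_set_def)

lemma minimal_selector_Field: "minimal_selector P S \<Longrightarrow> p \<in> S \<Longrightarrow> p \<in> Field P"
  using minimal_selector_selector selector_subset_Field by blast

locale omega =
  fixes P :: "'a rel"
  assumes omega: "omega_poset P"
begin

lemma reflP: "p \<in> Field P \<Longrightarrow> (p, p) \<in> P"
  and transP: "(p, q) \<in> P \<Longrightarrow> (q, r) \<in> P \<Longrightarrow> (p, r) \<in> P"
  and antisymP: "(p, q) \<in> P \<Longrightarrow> (q, p) \<in> P \<Longrightarrow> p = q"
  using omega unfolding omega_poset_def partial_order_on_def preorder_on_def
    refl_on_def trans_def antisym_def by blast+

lemma finite_above: "p \<in> Field P \<Longrightarrow> finite (above P p)"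
  using omega by (simp add: omega_poset_def)

lemma above_inj:
  assumes "p \<in> Field P" "q \<in> Field P" "above P p = above P q" shows "p = q"
proof -
  have "q \<in> above P q" "p \<in> above P p" using assms reflP by (auto simp: above_def)
  then have "q \<in> above P p" "p \<in> above P q" using assms(3) by simp_all
  then show ?thesis using antisymP by (simp add: above_def)
qed

lemma finite_card_above_eq: "finite {p \<in> Field P. card (above P p) = n}"
proof (rule finite_imageD)
  have "above P ` {p \<in> Field P. card (above P p) = n} = {F \<in> above P ` Field P. card F = n}"
    by auto
  then show "finite (above P ` {p \<in> Field P. card (above P p) = n})"
    using omega by (simp add: omega_poset_def)
  show "inj_on (above P) {p \<in> Field P. card (above P p) = n}"
    by (rule inj_onI) (auto intro: above_inj)
qed

lemma countable_Field: "countable (Field P)"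
proof -
  have "Field P = (\<Union>n. {p \<in> Field P. card (above P p) = n})" by auto
  then show ?thesis
    using countable_UN[of UNIV "\<lambda>n. {p \<in> Field P. card (above P p) = n}"] finite_card_above_eq
    by (simp add: countable_finite)
qed

text \<open>
  The elements whose strictly ascending chains all have fewer than \<open>n\<close> steps, i.e. those of rank below
  \<open>n\<close>. Counting chain length rather than the size of \<open>above P p\<close> is what makes the minimal elements of a
  stage a band: above each element outside \<open>stage n\<close> there is one of rank exactly \<open>n\<close>.
\<close>

primrec stage :: "nat \<Rightarrow> 'a set" where
  "stage 0 = {}"
| "stage (Suc n) = {p \<in> Field P. \<forall>q. (p, q) \<in> P \<and> q \<noteq> p \<longrightarrow> q \<in> stage n}"

lemma stage_subset: "stage n \<subseteq> Field P"
  by (cases n) auto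

lemma stage_Suc_mono: "stage n \<subseteq> stage (Suc n)"
  by (induction n) auto

lemma stage_mono: "m \<le> n \<Longrightarrow> stage m \<subseteq> stage n"
  using lift_Suc_mono_le[of stage, OF stage_Suc_mono] by blast

text \<open>
  An element of the next stage has its whole principal filter, apart from itself, in the present stage,
  so its filter has bounded size; an \<open>\<omega>\<close>-poset has only finitely many such elements.
\<close>

lemma finite_stage: "finite (stage n)"
proof (induction n)
  case (Suc n)
  have "stage (Suc n) \<subseteq> (\<Union>k\<le>Suc (card (stage n)). {p \<in> Field P. card (above P p) = k})"
  proof
    fix p assume p: "p \<in> stage (Suc n)"
    then have "above P p \<subseteq> insert p (stage n)" by (auto simp: above_def)
    then have "card (above P p) \<le> card (insert p (stage n))"
      using Suc.IH by (intro card_mono) auto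
    also have "\<dots> \<le> Suc (card (stage n))" using Suc.IH by (simp add: card_insert_if)
    finally have "card (above P p) \<le> Suc (card (stage n))" .
    with p show "p \<in> (\<Union>k\<le>Suc (card (stage n)). {p \<in> Field P. card (above P p) = k})" by auto
  qed
  then show ?case using finite_card_above_eq by (meson finite_UN_I finite_atMost finite_subset)
qed simp

lemma mem_stage_card_above: "p \<in> Field P \<Longrightarrow> p \<in> stage (card (above P p))"
proof (induction "card (above P p)" arbitrary: p rule: less_induct)
  case less
  have "card (above P p) \<noteq> 0"
    using less.prems finite_above reflP by (auto simp: above_def)
  then obtain n where n: "card (above P p) = Suc n" using not0_implies_Suc by blast
  have "q \<in> stage n" if q: "(p, q) \<in> P" "q \<noteq> p" for q
  proof -
    have qF: "q \<in> Field P" using q by (auto intro: FieldI2)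
    have "above P q \<subset> above P p"
      using q less.prems transP antisymP reflP unfolding above_def by blast
    then have *: "card (above P q) < card (above P p)"
      by (rule psubset_card_mono[OF finite_above[OF less.prems]])
    then show ?thesis
      using less.hyps[OF * qF] stage_mono[of "card (above P q)" n] n by auto
  qed
  then show ?case using less.prems n by simp
qed

lemma finite_subset_stage:
  assumes "finite K" "K \<subseteq> Field P" obtains n where "K \<subseteq> stage n"
proof -
  have "K \<subseteq> stage (Max ((\<lambda>p. card (above P p)) ` K))"
  proof
    fix p assume p: "p \<in> K"
    then have "card (above P p) \<le> Max ((\<lambda>p. card (above P p)) ` K)" using assms(1) by simp
    from stage_mono[OF this] mem_stage_card_above p assms(2)
    show "p \<in> stage (Max ((\<lambda>p. card (above P p)) ` K))" by blast
  qed
  then show ?thesis by (rule that)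
qed

definition level :: "nat \<Rightarrow> 'a set" where
  "level n = {p \<in> stage (Suc n). \<forall>r\<in>stage (Suc n). (r, p) \<in> P \<longrightarrow> r = p}"

lemma exists_minimal_below:
  assumes "finite A" "p \<in> A" "A \<subseteq> Field P"
  shows "\<exists>m\<in>A. (m, p) \<in> P \<and> (\<forall>r\<in>A. (r, m) \<in> P \<longrightarrow> r = m)"
  using assms
proof (induction "card {r \<in> A. (r, p) \<in> P}" arbitrary: p rule: less_induct)
  case less
  show ?case
  proof (cases "\<forall>r\<in>A. (r, p) \<in> P \<longrightarrow> r = p")
    case True
    then show ?thesis using less.prems reflP by blast
  next
    case False
    then obtain r where r: "r \<in> A" "(r, p) \<in> P" "r \<noteq> p" by blast
    have "{s \<in> A. (s, r) \<in> P} \<subset> {s \<in> A. (s, p) \<in> P}"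
      using r less.prems transP antisymP reflP by blast
    then have "card {s \<in> A. (s, r) \<in> P} < card {s \<in> A. (s, p) \<in> P}"
      using less.prems(1) by (intro psubset_card_mono) auto
    from less.hyps[OF this less.prems(1) r(1) less.prems(3)]
    show ?thesis using r transP by blast
  qed
qed

text \<open>
  Climb from \<open>p\<close> while staying outside \<open>stage n\<close>. The last element reached has everything above it in
  \<open>stage n\<close>, so it is in the next stage, and it is minimal there because everything below it has rank
  more than \<open>n\<close>.
\<close>

lemma exists_level_above:
  assumes "p \<in> Field P" "p \<notin> stage n"
  shows "\<exists>q\<in>level n. (p, q) \<in> P"
  using assms
proof (induction "card (above P p)" arbitrary: p rule: less_induct)
  case less
  show ?case
  proof (cases "p \<in> stage (Suc n)")
    case True
    have "r = p" if "r \<in> stage (Suc n)" "(r, p) \<in> P" for r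
      using that less.prems(2) by auto
    then show ?thesis using True reflP less.prems(1) by (auto simp: level_def)
  next
    case False
    then obtain q where q: "(p, q) \<in> P" "q \<noteq> p" "q \<notin> stage n" using less.prems by auto
    have qF: "q \<in> Field P" using q by (auto intro: FieldI2)
    have "above P q \<subset> above P p"
      using q less.prems transP antisymP reflP unfolding above_def by blast
    then have "card (above P q) < card (above P p)"
      by (rule psubset_card_mono[OF finite_above[OF less.prems(1)]])
    from less.hyps[OF this qF q(3)] show ?thesis using q transP by blast
  qed
qed

lemma band_level: "band P (level n)"
  unfolding band_def
proof (intro conjI ballI)
  show "finite (level n)"
    by (rule finite_subset[OF _ finite_stage[of "Suc n"]]) (auto simp: level_def)
  show "level n \<subseteq> Field P" by (auto simp: level_def)
  fix p assume p: "p \<in> Field P"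
  show "\<exists>b\<in>level n. (p, b) \<in> P \<or> (b, p) \<in> P"
  proof (cases "p \<in> stage n")
    case True
    then have "p \<in> stage (Suc n)" using stage_Suc_mono by blast
    from exists_minimal_below[OF finite_stage this stage_subset]
    show ?thesis unfolding level_def by blast
  next
    case False
    then show ?thesis using exists_level_above[OF p] by blast
  qed
qed

text \<open>
  Once all of \<open>K\<close> lies in \<open>stage n\<close>, no element of \<open>K\<close> is strictly below a member of \<open>level n\<close>. Hence a
  member comparable to an element of a band inside \<open>K\<close> must lie below it.
\<close>

lemma band_refining_level:
  assumes "finite K" "K \<subseteq> Field P"
  obtains n where "\<And>B. band P B \<Longrightarrow> B \<subseteq> K \<Longrightarrow> refines P (level n) B"
proof -
  obtain n where n: "K \<subseteq> stage n" using finite_subset_stage[OF assms] .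
  have "refines P (level n) B" if B: "band P B" "B \<subseteq> K" for B
    unfolding refines_def
  proof
    fix l assume l: "l \<in> level n"
    then obtain b where b: "b \<in> B" "(l, b) \<in> P \<or> (b, l) \<in> P"
      using B(1) band_level[of n] unfolding band_def by (meson subsetD)
    have "b \<in> stage (Suc n)" using b(1) B(2) n stage_Suc_mono by blast
    then have "(b, l) \<in> P \<Longrightarrow> b = l" using l by (auto simp: level_def)
    then show "\<exists>t\<in>B. (l, t) \<in> P" using b by blast
  qed
  then show ?thesis using that by blast
qed

lemma cap_level: "cap P (level n)"
  unfolding cap_def refines_def using band_level reflP
  by (meson band_def subsetD)

lemma caps_common_refinement:
  assumes "cap P C" "cap P D"
  obtains L where "cap P L" "refines P L C" "refines P L D"
proof -
  obtain A B where AB: "band P A" "refines P A C" "band P B" "refines P B D"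
    using assms by (auto simp: cap_def)
  then have "finite (A \<union> B)" "A \<union> B \<subseteq> Field P" by (auto simp: band_def)
  from band_refining_level[OF this] obtain n
    where "\<And>E. band P E \<Longrightarrow> E \<subseteq> A \<union> B \<Longrightarrow> refines P (level n) E" by blast
  then have "refines P (level n) A" "refines P (level n) B" using AB by auto
  then have "refines P (level n) C" "refines P (level n) D"
    using AB transP unfolding refines_def by meson+
  then show ?thesis using that cap_level by blast
qed

text \<open>
  Replacing \<open>p\<close> by the larger \<open>q\<close> in a cap that meets \<open>S\<close> only in \<open>p\<close> gives another cap, which \<open>S\<close> can
  meet only in \<open>q\<close>.
\<close>

lemma minimal_selector_upward_closed:
  assumes S: "minimal_selector P S" and p: "p \<in> S" and pq: "(p, q) \<in> P"
  shows "q \<in> S"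
proof (rule ccontr)
  assume q: "q \<notin> S"
  obtain C where C: "cap P C" "S \<inter> C = {p}" using minimal_selector_cap_singleton[OF S p] .
  have "cap P (insert q (C - {p}))"
  proof -
    obtain B where B: "band P B" "refines P B C" "C \<subseteq> Field P" using C(1) by (auto simp: cap_def)
    have "refines P B (insert q (C - {p}))"
      unfolding refines_def
    proof
      fix b assume "b \<in> B"
      then obtain c where "c \<in> C" "(b, c) \<in> P" using B(2) by (auto simp: refines_def)
      then show "\<exists>t\<in>insert q (C - {p}). (b, t) \<in> P" using pq transP by (cases "c = p") auto
    qed
    moreover have "insert q (C - {p}) \<subseteq> Field P" using B(3) pq by (auto intro: FieldI2)
    ultimately show ?thesis using B(1) by (auto simp: cap_def)
  qed
  from selector_meets_cap[OF minimal_selector_selector[OF S] this] C(2) q show False by blast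
qed

text \<open>
  Take caps meeting \<open>S\<close> only in \<open>p\<close> and only in \<open>q\<close>. An element of \<open>S\<close> in a common refinement lies below
  members of both caps, and by upward closure these belong to \<open>S\<close>.
\<close>

lemma minimal_selector_directed:
  assumes S: "minimal_selector P S" and "p \<in> S" "q \<in> S"
  shows "\<exists>r\<in>S. (r, p) \<in> P \<and> (r, q) \<in> P"
proof -
  obtain C where C: "cap P C" "S \<inter> C = {p}"
    using minimal_selector_cap_singleton[OF S \<open>p \<in> S\<close>] .
  obtain D where D: "cap P D" "S \<inter> D = {q}"
    using minimal_selector_cap_singleton[OF S \<open>q \<in> S\<close>] .
  obtain L where L: "cap P L" "refines P L C" "refines P L D"
    using caps_common_refinement[OF C(1) D(1)] .
  obtain r where r: "r \<in> L" "r \<in> S"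
    using selector_meets_cap[OF minimal_selector_selector[OF S] L(1)] by blast
  obtain c d where cd: "c \<in> C" "(r, c) \<in> P" "d \<in> D" "(r, d) \<in> P"
    using L r unfolding refines_def by blast
  then have "c \<in> S" "d \<in> S" using minimal_selector_upward_closed[OF S r(2)] by blast+
  then have "c = p" "d = q" using C(2) D(2) cd by blast+
  then show ?thesis using cd r by blast
qed

lemma minimal_selector_nonempty:
  assumes "minimal_selector P S" shows "S \<noteq> {}"
  using selector_meets_cap[OF minimal_selector_selector[OF assms] cap_level] by blast

text \<open>
  Because minimal selectors are filters, the subbasis of the spectrum is already a base. Nonemptiness of
  \<open>S\<close> handles the whole spectrum as a subbasic set.
\<close>

lemma spectrum_basis:
  assumes "openin (spectrum P) U" "S \<in> U"
  obtains p where "p \<in> S" "elem_set P p \<subseteq> U"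
proof -
  have S: "minimal_selector P S"
    using assms openin_subset[OF assms(1)] by (auto simp: mem_spectrum_set)
  have "generate_topology_on (insert (spectrum_set P) (elem_set P ` Field P)) U"
    using assms(1) unfolding spectrum_def by (rule openin_topology_generated_by)
  then have "S \<in> U \<longrightarrow> (\<exists>p\<in>S. elem_set P p \<subseteq> U)"
  proof (induction rule: generate_topology_on.induct)
    case (Int a b)
    show ?case
    proof
      assume "S \<in> a \<inter> b"
      then obtain p q where pq: "p \<in> S" "elem_set P p \<subseteq> a" "q \<in> S" "elem_set P q \<subseteq> b"
        using Int.IH by blast
      obtain r where "r \<in> S" "(r, p) \<in> P" "(r, q) \<in> P"
        using minimal_selector_directed[OF S pq(1,3)] by blast
      moreover have "elem_set P r \<subseteq> elem_set P p \<inter> elem_set P q"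
        using calculation minimal_selector_upward_closed by (auto simp: mem_elem_set)
      ultimately show "\<exists>p\<in>S. elem_set P p \<subseteq> a \<inter> b" using pq by blast
    qed
  next
    case (UN K)
    then show ?case by blast
  next
    case (Basis s)
    then show ?case
      using minimal_selector_nonempty[OF S] by (auto simp: mem_elem_set elem_set_def)
  qed simp
  with assms(2) that show ?thesis by blast
qed

lemma compact_space_spectrum: "compact_space (spectrum P)"
  unfolding compact_space_alt
proof (intro allI impI, elim conjE)
  fix \<U> assume \<U>: "\<forall>U\<in>\<U>. openin (spectrum P) U" and cover: "topspace (spectrum P) \<subseteq> \<Union>\<U>"
  define A where "A = {p \<in> Field P. \<exists>U\<in>\<U>. elem_set P p \<subseteq> U}"
  have "cap P A"
  proof (rule cap_if_meets_minimal_selectors)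
    fix S assume S: "minimal_selector P S"
    then obtain U where U: "U \<in> \<U>" "S \<in> U" using cover by (auto simp: mem_spectrum_set)
    then obtain p where "p \<in> S" "elem_set P p \<subseteq> U" using \<U> spectrum_basis by metis
    then show "S \<inter> A \<noteq> {}" using U(1) minimal_selector_Field[OF S] by (auto simp: A_def)
  qed (simp add: A_def)
  then obtain D where D: "D \<subseteq> A" "finite D" "cap P D" by (rule finite_subcap)
  then have "\<forall>d\<in>D. \<exists>U\<in>\<U>. elem_set P d \<subseteq> U" by (auto simp: A_def)
  then obtain f where f: "\<And>d. d \<in> D \<Longrightarrow> f d \<in> \<U> \<and> elem_set P d \<subseteq> f d" by metis
  have "topspace (spectrum P) \<subseteq> \<Union>(f ` D)"
  proof
    fix S assume "S \<in> topspace (spectrum P)"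
    then have S: "minimal_selector P S" by (simp add: mem_spectrum_set)
    from selector_meets_cap[OF minimal_selector_selector[OF this] D(3)]
    obtain d where "d \<in> D" "d \<in> S" by blast
    then have "S \<in> f d" using f[of d] S by (auto simp: mem_elem_set)
    then show "S \<in> \<Union>(f ` D)" using \<open>d \<in> D\<close> by blast
  qed
  then show "\<exists>\<F>. finite \<F> \<and> \<F> \<subseteq> \<U> \<and> topspace (spectrum P) \<subseteq> \<Union>\<F>"
    using f D(2) by (intro exI[of _ "f ` D"]) auto
qed

end


section \<open>Regular prime posets have compact metrisable spectra\<close>

text \<open>
  By compactness, countably many separating functions embed \<open>X\<close> into a countable power of the real line.
\<close>

lemma separating_countable_imp_metrizable:
  fixes f :: "'i \<Rightarrow> 'x \<Rightarrow> real"
  assumes "compact_space X" "countable I"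
    and cont: "\<And>i. i \<in> I \<Longrightarrow> continuous_map X euclideanreal (f i)"
    and sep: "\<And>x y. x \<in> topspace X \<Longrightarrow> y \<in> topspace X \<Longrightarrow> x \<noteq> y \<Longrightarrow> \<exists>i\<in>I. f i x \<noteq> f i y"
  shows "metrizable_space X"
proof -
  define Y where "Y = product_topology (\<lambda>_::'i. euclideanreal) I"
  define F where "F = (\<lambda>x. \<lambda>i\<in>I. f i x)"
  have "metrizable_space Y"
    unfolding Y_def metrizable_space_product_topology
    using assms(2) metrizable_space_euclidean by (auto intro: countable_subset)
  have "continuous_map X Y F"
    unfolding Y_def continuous_map_componentwise F_def using cont by auto
  moreover have "inj_on F (topspace X)"
  proof (rule inj_onI, rule ccontr)
    fix x y assume xy: "x \<in> topspace X" "y \<in> topspace X" "F x = F y" "x \<noteq> y"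
    then obtain i where "i \<in> I" "f i x \<noteq> f i y" using sep by blast
    then show False using fun_cong[OF xy(3), of i] by (simp add: F_def)
  qed
  ultimately have "embedding_map X Y F"
    using assms(1) \<open>metrizable_space Y\<close>
    by (intro continuous_imp_embedding_map metrizable_imp_Hausdorff_space)
  then have "X homeomorphic_space (subtopology Y (F ` topspace X))"
    by (rule embedding_map_imp_homeomorphic_space)
  then show ?thesis
    using homeomorphic_metrizable_space metrizable_space_subtopology[OF \<open>metrizable_space Y\<close>] by blast
qed

locale regular_prime_omega = omega +
  assumes prime: "prime_poset P" and regular: "regular_poset P"
begin

lemma wedge_iff_common_selector:
  assumes "p \<in> Field P" "q \<in> Field P"
  shows "wedge P p q \<longleftrightarrow> (\<exists>S. minimal_selector P S \<and> p \<in> S \<and> q \<in> S)"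
proof
  assume "wedge P p q"
  then obtain r where r: "r \<in> Field P" "(r, p) \<in> P" "(r, q) \<in> P" by (auto simp: wedge_def)
  then obtain S where "minimal_selector P S" "r \<in> S" using prime by (auto simp: prime_poset_def)
  then show "\<exists>S. minimal_selector P S \<and> p \<in> S \<and> q \<in> S"
    using r minimal_selector_upward_closed by blast
next
  assume "\<exists>S. minimal_selector P S \<and> p \<in> S \<and> q \<in> S"
  then obtain S where S: "minimal_selector P S" "p \<in> S" "q \<in> S" by blast
  show "wedge P p q"
    unfolding wedge_def
    using minimal_selector_directed[OF S] minimal_selector_Field[OF S(1)] by blast
qed

text \<open>
  The cap witnessing \<open>p \<triangleleft> q\<close> meets \<open>S\<close> in some \<open>c\<close>, which is below \<open>q\<close> or apart from \<open>p\<close>. In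
  topological terms, the closure of \<open>elem_set P p\<close> is contained in \<open>elem_set P q\<close>.
\<close>

lemma star_below_selector:
  assumes "star_below P p q" and S: "minimal_selector P S"
  shows "q \<in> S \<or> (\<exists>c\<in>S. \<not> wedge P c p)"
proof -
  obtain C where C: "cap P C" "\<And>c. c \<in> C \<Longrightarrow> wedge P c p \<Longrightarrow> (c, q) \<in> P"
    using assms(1) by (auto simp: star_below_def star_in_def)
  obtain c where "c \<in> C" "c \<in> S"
    using selector_meets_cap[OF minimal_selector_selector[OF S] C(1)] by blast
  then show ?thesis using C(2) minimal_selector_upward_closed[OF S] by blast
qed

text \<open>
  Apply regularity to a cap that meets \<open>S\<close> only in \<open>p\<close>. The refining cap meets \<open>S\<close> in some \<open>c\<close> with
  \<open>c \<triangleleft> d\<close>; every element of \<open>S\<close> has a common lower bound with \<open>c\<close>, so \<open>d\<close> is in \<open>S\<close> and hence is \<open>p\<close>.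
\<close>

lemma minimal_selector_round:
  assumes S: "minimal_selector P S" and p: "p \<in> S"
  obtains c where "c \<in> S" "star_below P c p"
proof -
  obtain D where D: "cap P D" "S \<inter> D = {p}" using minimal_selector_cap_singleton[OF S p] .
  have "\<exists>C. cap P C \<and> (\<forall>c\<in>C. \<exists>d\<in>D. star_below P c d)"
    using regular D(1) by (simp add: regular_poset_def)
  then obtain C where C: "cap P C" "\<forall>c\<in>C. \<exists>d\<in>D. star_below P c d" by blast
  obtain c where c: "c \<in> C" "c \<in> S"
    using selector_meets_cap[OF minimal_selector_selector[OF S] C(1)] by blast
  obtain d where d: "d \<in> D" "star_below P c d" using C(2) c(1) by blast
  have "wedge P e c" if "e \<in> S" for e
    using that c(2) S wedge_iff_common_selector[of e c] minimal_selector_Field[OF S] by blast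
  then have "d \<in> S" using star_below_selector[OF d(2) S] by blast
  then have "d = p" using D(2) d(1) by blast
  with d(2) show ?thesis by (intro that[OF c(2)]) simp
qed

lemma elem_set_disjoint:
  assumes "\<not> wedge P p q" "p \<in> Field P" "q \<in> Field P"
  shows "disjnt (elem_set P p) (elem_set P q)"
  using assms wedge_iff_common_selector by (auto simp: disjnt_def mem_elem_set)

lemma Hausdorff_space_spectrum: "Hausdorff_space (spectrum P)"
  unfolding Hausdorff_space_def
proof (intro allI impI)
  fix S T assume "S \<in> topspace (spectrum P) \<and> T \<in> topspace (spectrum P) \<and> S \<noteq> T"
  then have S: "minimal_selector P S" and T: "minimal_selector P T" and "S \<noteq> T"
    by (auto simp: mem_spectrum_set)
  then obtain p where p: "p \<in> S" "p \<notin> T"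
    using minimal_selector_eqI[OF T minimal_selector_selector[OF S]] by blast
  obtain c where c: "c \<in> S" "star_below P c p" using minimal_selector_round[OF S p(1)] .
  then obtain e where e: "e \<in> T" "\<not> wedge P e c" using star_below_selector[OF c(2) T] p(2) by blast
  have F: "c \<in> Field P" "e \<in> Field P"
    using minimal_selector_Field[OF S c(1)] minimal_selector_Field[OF T e(1)] .
  have "disjnt (elem_set P c) (elem_set P e)"
    by (rule disjnt_sym[OF elem_set_disjoint[OF e(2) F(2) F(1)]])
  moreover have "S \<in> elem_set P c" "T \<in> elem_set P e" using S T c(1) e(1) by (simp_all add: mem_elem_set)
  ultimately show "\<exists>U V. openin (spectrum P) U \<and> openin (spectrum P) V \<and> S \<in> U \<and> T \<in> V \<and> disjnt U V"
    using openin_elem_set[OF F(1)] openin_elem_set[OF F(2)] by blast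
qed

lemma closure_elem_set_subset:
  assumes "star_below P p q"
  shows "spectrum P closure_of elem_set P p \<subseteq> elem_set P q"
proof
  fix S assume S: "S \<in> spectrum P closure_of elem_set P p"
  then have Smin: "minimal_selector P S"
    using closure_of_subset_topspace[of "spectrum P" "elem_set P p"] by (auto simp: mem_spectrum_set)
  have pF: "p \<in> Field P" using assms by (simp add: star_below_def)
  have "wedge P c p" if c: "c \<in> S" for c
  proof (rule ccontr)
    assume *: "\<not> wedge P c p"
    have cF: "c \<in> Field P" by (rule minimal_selector_Field[OF Smin c])
    have "S \<in> elem_set P c" using c Smin by (simp add: mem_elem_set)
    then obtain T where "T \<in> elem_set P p" "T \<in> elem_set P c"
      using S openin_elem_set[OF cF] by (auto simp: in_closure_of)
    then show False using elem_set_disjoint[OF * cF pF] by (auto simp: disjnt_def)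
  qed
  then show "S \<in> elem_set P q" using star_below_selector[OF assms Smin] Smin by (auto simp: mem_elem_set)
qed

text \<open>
  A pair \<open>p \<triangleleft> q\<close> gives a Urysohn function that is 0 on \<open>elem_set P p\<close> and 1 off \<open>elem_set P q\<close>. By
  roundness these countably many functions separate the points.
\<close>

lemma metrizable_space_spectrum: "metrizable_space (spectrum P)"
proof -
  define I where "I = {(p, q). star_below P p q}"
  have normal: "normal_space (spectrum P)"
    by (simp add: compact_Hausdorff_or_regular_imp_normal_space compact_space_spectrum Hausdorff_space_spectrum)
  have "\<exists>f. continuous_map (spectrum P) euclideanreal f \<and>
          (\<forall>S\<in>elem_set P p. f S = 0) \<and> (\<forall>S\<in>spectrum_set P - elem_set P q. f S = 1)"
    if "star_below P p q" for p q
  proof -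
    let ?A = "spectrum P closure_of elem_set P p" and ?B = "topspace (spectrum P) - elem_set P q"
    have qF: "q \<in> Field P" using that by (simp add: star_below_def)
    have "closedin (spectrum P) ?B" using openin_elem_set[OF qF] by blast
    moreover have "disjnt ?A ?B" using closure_elem_set_subset[OF that] by (auto simp: disjnt_def)
    ultimately obtain f where f: "continuous_map (spectrum P) (top_of_set {0..1}) f"
      "f ` ?A \<subseteq> {0::real}" "f ` ?B \<subseteq> {1}"
      using Urysohn_lemma[OF normal closedin_closure_of, where a = 0 and b = 1] by (metis zero_le_one)
    have "elem_set P p \<subseteq> ?A"
      by (intro closure_of_subset) (auto simp: elem_set_def)
    then show ?thesis using f by (intro exI[of _ f]) (auto simp: continuous_map_in_subtopology)
  qed
  then obtain f where f: "\<And>p q. star_below P p q \<Longrightarrow> continuous_map (spectrum P) euclideanreal (f p q) \<and>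
          (\<forall>S\<in>elem_set P p. f p q S = 0) \<and> (\<forall>S\<in>spectrum_set P - elem_set P q. f p q S = 1)"
    by metis
  show ?thesis
  proof (rule separating_countable_imp_metrizable)
    show "countable I"
      by (rule countable_subset[OF _ countable_SIGMA[of "Field P" "\<lambda>_. Field P"]])
         (auto simp: I_def star_below_def countable_Field)
    show "continuous_map (spectrum P) euclideanreal ((\<lambda>(p, q). f p q) i)" if "i \<in> I" for i
      using that f by (auto simp: I_def)
    fix S T assume ST: "S \<in> topspace (spectrum P)" "T \<in> topspace (spectrum P)" "S \<noteq> T"
    then have S: "minimal_selector P S" and T: "minimal_selector P T" by (auto simp: mem_spectrum_set)
    obtain q where q: "q \<in> S" "q \<notin> T"
      using minimal_selector_eqI[OF T minimal_selector_selector[OF S]] ST(3) by blast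
    obtain p where p: "p \<in> S" "star_below P p q" using minimal_selector_round[OF S q(1)] .
    have "f p q S = 0" using f[OF p(2)] p(1) S by (auto simp: mem_elem_set)
    moreover have "f p q T = 1" using f[OF p(2)] q(2) T by (auto simp: mem_elem_set mem_spectrum_set)
    ultimately show "\<exists>i\<in>I. (case i of (p, q) \<Rightarrow> f p q) S \<noteq> (case i of (p, q) \<Rightarrow> f p q) T"
      using p(2) by (intro bexI[of _ "(p, q)"]) (auto simp: I_def)
  qed (rule compact_space_spectrum)
qed

end

section \<open>The spectrum functor\<close>

lemma Obj_poset_category:
  "P \<in> Obj poset_category \<longleftrightarrow> regular_prime_omega P"
  by (simp add: poset_category_def regular_prime_omega_def omega_def regular_prime_omega_axioms_def)

lemma spectrum_Obj:
  "P \<in> Obj poset_category \<Longrightarrow> spectrum P \<in> Obj compact_metrizable_category"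
  by (simp add: Obj_poset_category compact_metrizable_category_def omega.compact_space_spectrum
      regular_prime_omega.metrizable_space_spectrum regular_prime_omega.axioms(1))

lemma Image_selector:
  assumes "refiner P Q \<rho>" and S: "selector P S"
  shows "selector Q (\<rho>\<inverse> `` S)"
  unfolding selector_def
proof (intro conjI allI impI)
  show "\<rho>\<inverse> `` S \<subseteq> Field Q" using assms(1) by (auto simp: refiner_def)
  fix D assume "cap Q D"
  then obtain C where C: "cap P C" "\<And>c. c \<in> C \<Longrightarrow> \<exists>d\<in>D. (d, c) \<in> \<rho>"
    using assms(1) unfolding refiner_def by blast
  then show "\<rho>\<inverse> `` S \<inter> D \<noteq> {}" using selector_meets_cap[OF S C(1)] by blast
qed

text \<open>
  Any two elements of the image of \<open>S\<close> have a common lower bound. So if \<open>q'\<close> is in the image and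
  \<open>q' \<triangleleft> q\<close>, no element of \<open>M\<close> is apart from \<open>q'\<close>, which forces \<open>q \<in> M\<close>; conversely, roundness of \<open>M\<close>
  puts each of its elements into \<open>\<phi>\<^sub>\<rho>(S)\<close>. Thus \<open>\<phi>\<^sub>\<rho>(S)\<close> can be recognised as the only minimal selector
  inside the image, with no further reference to \<open>\<triangleleft>\<close>.
\<close>

lemma spectrum_map_eqI:
  assumes P: "regular_prime_omega P" and Q: "regular_prime_omega Q"
    and \<rho>: "refiner P Q \<rho>" "wedge_preserving P Q \<rho>"
    and S: "minimal_selector P S" and M: "minimal_selector Q M" "M \<subseteq> \<rho>\<inverse> `` S"
  shows "spectrum_map P Q \<rho> S = M"
proof -
  interpret P: regular_prime_omega P by fact
  interpret Q: regular_prime_omega Q by fact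
  have wedge: "wedge Q q q'" if "q \<in> \<rho>\<inverse> `` S" "q' \<in> \<rho>\<inverse> `` S" for q q'
  proof -
    obtain p p' where pp: "(q, p) \<in> \<rho>" "p \<in> S" "(q', p') \<in> \<rho>" "p' \<in> S" using \<open>q \<in> _\<close> \<open>q' \<in> _\<close> by blast
    have "wedge P p p'"
      using pp S P.wedge_iff_common_selector[of p p'] minimal_selector_Field[OF S] by blast
    then show ?thesis
      using pp \<rho> minimal_selector_Field[OF S] unfolding wedge_preserving_def refiner_def by blast
  qed
  have "spectrum_map P Q \<rho> S
        = {q \<in> Field Q. \<exists>p\<in>S. \<exists>q'\<in>Field Q. (q', p) \<in> \<rho> \<and> star_below Q q' q}"
    using S by (simp add: spectrum_map_def mem_spectrum_set)
  also have "\<dots> = M"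
  proof (intro equalityI subsetI)
    fix q assume "q \<in> {q \<in> Field Q. \<exists>p\<in>S. \<exists>q'\<in>Field Q. (q', p) \<in> \<rho> \<and> star_below Q q' q}"
    then obtain p q' where q': "p \<in> S" "(q', p) \<in> \<rho>" "star_below Q q' q" by blast
    have "wedge Q c q'" if "c \<in> M" for c using wedge[of c q'] that q' M(2) by blast
    then show "q \<in> M" using Q.star_below_selector[OF q'(3) M(1)] by blast
  next
    fix q assume q: "q \<in> M"
    obtain c where "c \<in> M" "star_below Q c q" using Q.minimal_selector_round[OF M(1) q] .
    then show "q \<in> {q \<in> Field Q. \<exists>p\<in>S. \<exists>q'\<in>Field Q. (q', p) \<in> \<rho> \<and> star_below Q q' q}"
      using M(2) q minimal_selector_Field[OF M(1)] by blast
  qed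
  finally show ?thesis .
qed

lemma spectrum_map_minimal_selector:
  assumes "regular_prime_omega P" "regular_prime_omega Q"
    and "refiner P Q \<rho>" "wedge_preserving P Q \<rho>" and S: "minimal_selector P S"
  shows "minimal_selector Q (spectrum_map P Q \<rho> S)" "spectrum_map P Q \<rho> S \<subseteq> \<rho>\<inverse> `` S"
proof -
  obtain M where "minimal_selector Q M" "M \<subseteq> \<rho>\<inverse> `` S"
    using selector_contains_minimal[OF Image_selector[OF assms(3) minimal_selector_selector[OF S]]] .
  moreover from this have "spectrum_map P Q \<rho> S = M" using spectrum_map_eqI assms by blast
  ultimately show "minimal_selector Q (spectrum_map P Q \<rho> S)" "spectrum_map P Q \<rho> S \<subseteq> \<rho>\<inverse> `` S" by auto
qed

lemma continuous_spectrum_map: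
  assumes "regular_prime_omega P" "regular_prime_omega Q" "refiner P Q \<rho>" "wedge_preserving P Q \<rho>"
  shows "continuous_map (spectrum P) (spectrum Q) (spectrum_map P Q \<rho>)"
proof -
  let ?\<phi> = "spectrum_map P Q \<rho>"
  have \<phi>: "?\<phi> S \<in> spectrum_set Q" if "S \<in> spectrum_set P" for S
    using spectrum_map_minimal_selector(1)[OF assms] that by (simp add: mem_spectrum_set)
  have elem: "openin (spectrum P) (?\<phi> -` elem_set Q q \<inter> spectrum_set P)" if q: "q \<in> Field Q" for q
  proof -
    have mem: "S \<in> ?\<phi> -` elem_set Q q \<longleftrightarrow> (\<exists>p\<in>S. \<exists>q'\<in>Field Q. (q', p) \<in> \<rho> \<and> star_below Q q' q)"
      if S: "S \<in> spectrum_set P" for S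
      using \<phi>[OF S] S q by (auto simp: elem_set_def spectrum_map_def)
    have "?\<phi> -` elem_set Q q \<inter> spectrum_set P
        = \<Union>(elem_set P ` {p \<in> Field P. \<exists>q'\<in>Field Q. (q', p) \<in> \<rho> \<and> star_below Q q' q})"
    proof (intro equalityI subsetI)
      fix S assume "S \<in> ?\<phi> -` elem_set Q q \<inter> spectrum_set P"
      then have S: "S \<in> spectrum_set P" and "S \<in> ?\<phi> -` elem_set Q q" by auto
      then obtain p where p: "p \<in> S" "\<exists>q'\<in>Field Q. (q', p) \<in> \<rho> \<and> star_below Q q' q"
        using mem[OF S] by blast
      have "p \<in> Field P" using p(1) S minimal_selector_Field[of P S p] by (simp add: mem_spectrum_set)
      then show "S \<in> \<Union>(elem_set P ` {p \<in> Field P. \<exists>q'\<in>Field Q. (q', p) \<in> \<rho> \<and> star_below Q q' q})"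
        using p S by (auto simp: elem_set_def)
    next
      fix S assume "S \<in> \<Union>(elem_set P ` {p \<in> Field P. \<exists>q'\<in>Field Q. (q', p) \<in> \<rho> \<and> star_below Q q' q})"
      then obtain p where p: "S \<in> elem_set P p" "\<exists>q'\<in>Field Q. (q', p) \<in> \<rho> \<and> star_below Q q' q"
        by blast
      then show "S \<in> ?\<phi> -` elem_set Q q \<inter> spectrum_set P"
        using mem[of S] by (auto simp: elem_set_def)
    qed
    then show ?thesis using openin_elem_set by (auto intro!: openin_Union)
  qed
  have "openin (spectrum P) (?\<phi> -` spectrum_set Q \<inter> spectrum_set P)"
  proof -
    have "?\<phi> -` spectrum_set Q \<inter> spectrum_set P = topspace (spectrum P)" using \<phi> by auto
    then show ?thesis by (metis openin_topspace)
  qed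
  with elem \<phi> show ?thesis
    unfolding spectrum_def[of Q] continuous_on_generated_topo_iff topspace_spectrum by blast
qed

lemma Hom_poset_category: "\<rho> \<in> Hom poset_category P Q \<longleftrightarrow> refiner P Q \<rho> \<and> wedge_preserving P Q \<rho>"
  by (simp add: poset_category_def)

lemma spectrum_map_Hom:
  assumes "P \<in> Obj poset_category" "Q \<in> Obj poset_category" "\<rho> \<in> Hom poset_category P Q"
  shows "spectrum_map P Q \<rho> \<in> Hom compact_metrizable_category (spectrum P) (spectrum Q)"
proof -
  have "continuous_map (spectrum P) (spectrum Q) (spectrum_map P Q \<rho>)"
    using assms unfolding Obj_poset_category Hom_poset_category by (intro continuous_spectrum_map) auto
  moreover have "spectrum_map P Q \<rho> \<in> extensional (spectrum_set P)" by (simp add: spectrum_map_def)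
  ultimately show ?thesis by (simp add: compact_metrizable_category_def)
qed

lemma refiner_Id_on: "refiner P P (Id_on (Field P))"
  unfolding refiner_def using cap_subset_Field by fastforce

lemma wedge_preserving_Id_on: "wedge_preserving P P (Id_on (Field P))"
  unfolding wedge_preserving_def by auto

lemma refiner_relcomp:
  assumes "refiner P Q \<rho>" "refiner Q R \<sigma>" shows "refiner P R (\<sigma> O \<rho>)"
  unfolding refiner_def
proof (intro conjI allI impI)
  show "\<sigma> O \<rho> \<subseteq> Field R \<times> Field P" using assms by (auto simp: refiner_def)
  fix D assume "cap R D"
  then obtain C where C: "cap Q C" "\<forall>c\<in>C. \<exists>d\<in>D. (d, c) \<in> \<sigma>" using assms(2) unfolding refiner_def by meson
  then obtain B where "cap P B" "\<forall>b\<in>B. \<exists>c\<in>C. (c, b) \<in> \<rho>" using assms(1) unfolding refiner_def by meson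
  then show "\<exists>B. cap P B \<and> (\<forall>b\<in>B. \<exists>d\<in>D. (d, b) \<in> \<sigma> O \<rho>)" using C(2) by (meson relcompI)
qed

lemma wedge_preserving_relcomp:
  assumes "refiner P Q \<rho>" "wedge_preserving P Q \<rho>" "wedge_preserving Q R \<sigma>"
  shows "wedge_preserving P R (\<sigma> O \<rho>)"
  unfolding wedge_preserving_def
proof (intro ballI impI, elim conjE relcompE, clarify)
  fix p p' r r' q q'
  assume *: "p \<in> Field P" "p' \<in> Field P" "r \<in> Field R" "r' \<in> Field R" "wedge P p p'"
    "(r, q) \<in> \<sigma>" "(q, p) \<in> \<rho>" "(r', q') \<in> \<sigma>" "(q', p') \<in> \<rho>"
  then have F: "q \<in> Field Q" "q' \<in> Field Q" using assms(1) by (auto simp: refiner_def)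
  then have "wedge Q q q'" using * assms(2) unfolding wedge_preserving_def by blast
  then show "wedge R r r'" using * F assms(3) unfolding wedge_preserving_def by blast
qed

lemma category_posets: "is_category poset_category"
proof -
  have comp: "Comp poset_category P Q R \<sigma> \<rho> = \<sigma> O \<rho>" and
    idm: "Idm poset_category P = Id_on (Field P)" for P Q R :: "'a rel" and \<sigma> \<rho>
    by (simp_all add: poset_category_def)
  show ?thesis
    unfolding is_category_def comp idm
  proof (intro conjI ballI)
    fix P :: "'a rel"
    show "Id_on (Field P) \<in> Hom poset_category P P"
      by (simp add: Hom_poset_category refiner_Id_on wedge_preserving_Id_on)
  next
    fix P Q R :: "'a rel" and \<rho> \<sigma>
    assume "\<rho> \<in> Hom poset_category P Q" "\<sigma> \<in> Hom poset_category Q R"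
    then show "\<sigma> O \<rho> \<in> Hom poset_category P R"
      using refiner_relcomp[of P Q \<rho> R \<sigma>] wedge_preserving_relcomp[of P Q \<rho> R \<sigma>]
      unfolding Hom_poset_category by blast
  next
    fix P Q :: "'a rel" and \<rho>
    assume "\<rho> \<in> Hom poset_category P Q"
    then have "\<rho> \<subseteq> Field Q \<times> Field P" by (simp add: Hom_poset_category refiner_def)
    then show "\<rho> O Id_on (Field P) = \<rho>" "Id_on (Field Q) O \<rho> = \<rho>" by auto
  next
    fix P Q R :: "'a rel" and \<rho> \<sigma> \<tau> :: "'a rel"
    show "\<tau> O (\<sigma> O \<rho>) = (\<tau> O \<sigma>) O \<rho>" by (simp add: O_assoc)
  qed
qed

lemma category_compact_metrizable: "is_category (compact_metrizable_category :: ('x topology, 'x \<Rightarrow> 'x) category)"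
  unfolding is_category_def compact_metrizable_category_def
proof (simp, intro conjI allI impI)
  fix X Y Z :: "'x topology" and f g
  assume *: "compact_space X \<and> metrizable_space X" "continuous_map X Y f \<and> f \<in> extensional (topspace X)"
    "continuous_map Y Z g \<and> g \<in> extensional (topspace Y)"
  have "continuous_map X Z (g \<circ> f)" using * continuous_map_compose by blast
  then show "continuous_map X Z (compose (topspace X) g f)"
    by (rule continuous_map_eq) (auto simp: compose_def)
qed (auto intro!: ext simp: compose_def extensional_def continuous_map_def Pi_iff)

lemma spectrum_map_Id_on:
  assumes "regular_prime_omega P"
  shows "spectrum_map P P (Id_on (Field P)) = (\<lambda>S\<in>spectrum_set P. S)"
proof
  fix S
  show "spectrum_map P P (Id_on (Field P)) S = (\<lambda>S\<in>spectrum_set P. S) S"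
  proof (cases "minimal_selector P S")
    case True
    then have "S \<subseteq> (Id_on (Field P))\<inverse> `` S" using minimal_selector_Field[OF True] by blast
    with True show ?thesis
      using spectrum_map_eqI[OF assms assms refiner_Id_on wedge_preserving_Id_on True True]
      by (simp add: mem_spectrum_set)
  qed (simp add: spectrum_map_def mem_spectrum_set)
qed

lemma spectrum_map_relcomp:
  assumes P: "regular_prime_omega P" and Q: "regular_prime_omega Q" and R: "regular_prime_omega R"
    and \<rho>: "refiner P Q \<rho>" "wedge_preserving P Q \<rho>"
    and \<sigma>: "refiner Q R \<sigma>" "wedge_preserving Q R \<sigma>"
  shows "spectrum_map P R (\<sigma> O \<rho>) = compose (spectrum_set P) (spectrum_map Q R \<sigma>) (spectrum_map P Q \<rho>)"
proof
  fix S
  show "spectrum_map P R (\<sigma> O \<rho>) S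
      = compose (spectrum_set P) (spectrum_map Q R \<sigma>) (spectrum_map P Q \<rho>) S"
  proof (cases "minimal_selector P S")
    case True
    let ?M = "spectrum_map P Q \<rho> S" and ?N = "spectrum_map Q R \<sigma> (spectrum_map P Q \<rho> S)"
    have M: "minimal_selector Q ?M" "?M \<subseteq> \<rho>\<inverse> `` S"
      using spectrum_map_minimal_selector[OF P Q \<rho> True] .
    have N: "minimal_selector R ?N" "?N \<subseteq> \<sigma>\<inverse> `` ?M"
      using spectrum_map_minimal_selector[OF Q R \<sigma> M(1)] .
    have "?N \<subseteq> (\<sigma> O \<rho>)\<inverse> `` S" using M(2) N(2) by blast
    moreover have "wedge_preserving P R (\<sigma> O \<rho>)"
      using wedge_preserving_relcomp[OF \<rho> \<sigma>(2)] .
    ultimately have "spectrum_map P R (\<sigma> O \<rho>) S = ?N"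
      using spectrum_map_eqI[OF P R refiner_relcomp[OF \<rho>(1) \<sigma>(1)] _ True N(1)] by blast
    with True show ?thesis by (simp add: compose_def mem_spectrum_set)
  qed (simp add: spectrum_map_def compose_def mem_spectrum_set)
qed

theorem spectrum_functor:
  "is_functor (poset_category :: ('a rel, 'a rel) category) compact_metrizable_category spectrum spectrum_map"
  unfolding is_functor_def
proof (intro conjI ballI)
  fix P :: "'a rel" assume P: "P \<in> Obj poset_category"
  show "spectrum_map P P (Idm poset_category P) = Idm compact_metrizable_category (spectrum P)"
    using spectrum_map_Id_on P
    by (simp add: Obj_poset_category) (simp add: poset_category_def compact_metrizable_category_def)
next
  fix P Q R :: "'a rel" and \<rho> \<sigma>
  assume "P \<in> Obj poset_category" "Q \<in> Obj poset_category" "R \<in> Obj poset_category"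
    "\<rho> \<in> Hom poset_category P Q" "\<sigma> \<in> Hom poset_category Q R"
  then have "spectrum_map P R (\<sigma> O \<rho>) = compose (spectrum_set P) (spectrum_map Q R \<sigma>) (spectrum_map P Q \<rho>)"
    unfolding Obj_poset_category Hom_poset_category by (intro spectrum_map_relcomp) auto
  then show "spectrum_map P R (Comp poset_category P Q R \<sigma> \<rho>)
      = Comp compact_metrizable_category (spectrum P) (spectrum Q) (spectrum R)
          (spectrum_map Q R \<sigma>) (spectrum_map P Q \<rho>)"
    by (simp add: poset_category_def compact_metrizable_category_def)
qed (simp_all add: category_posets category_compact_metrizable spectrum_Obj spectrum_map_Hom)

section \<open>Fullness\<close>

definition inclusion_refiner :: "'p rel \<Rightarrow> 'q rel \<Rightarrow> ('p set \<Rightarrow> 'q set) \<Rightarrow> ('q \<times> 'p) set" where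
  "inclusion_refiner P Q h =
     {(q, p). q \<in> Field Q \<and> p \<in> Field P \<and> h ` elem_set P p \<subseteq> elem_set Q q}"

text \<open>
  The elements related to some member of a cap \<open>D\<close> form a cap, because each minimal selector \<open>S\<close> contains
  one: \<open>h S\<close> meets \<open>D\<close> in some \<open>d\<close>, and by continuity the preimage of \<open>elem_set Q d\<close> contains a
  basic neighbourhood of \<open>S\<close>.
\<close>

lemma refiner_inclusion_refiner:
  assumes P: "omega_poset P" and h: "continuous_map (spectrum P) (spectrum Q) h"
  shows "refiner P Q (inclusion_refiner P Q h)"
  unfolding refiner_def
proof (intro conjI allI impI)
  interpret omega P by (rule omega.intro) fact
  show "inclusion_refiner P Q h \<subseteq> Field Q \<times> Field P" by (auto simp: inclusion_refiner_def)
  fix D assume D: "cap Q D"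
  define C where "C = {p \<in> Field P. \<exists>d\<in>D. (d, p) \<in> inclusion_refiner P Q h}"
  have "cap P C"
  proof (rule cap_if_meets_minimal_selectors)
    fix S assume S: "minimal_selector P S"
    have hS: "minimal_selector Q (h S)"
      using continuous_map_image_subset_topspace[OF h] S
      by (auto simp: mem_spectrum_set[symmetric])
    obtain d where d: "d \<in> D" "d \<in> h S"
      using selector_meets_cap[OF minimal_selector_selector[OF hS] D] by blast
    have dF: "d \<in> Field Q" by (rule minimal_selector_Field[OF hS d(2)])
    have "openin (spectrum P) {T \<in> topspace (spectrum P). h T \<in> elem_set Q d}"
      using openin_continuous_map_preimage[OF h openin_elem_set[OF dF]] .
    moreover have "S \<in> {T \<in> topspace (spectrum P). h T \<in> elem_set Q d}"
      using S hS d by (simp add: mem_spectrum_set mem_elem_set)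
    ultimately obtain p where p: "p \<in> S" "elem_set P p \<subseteq> {T \<in> topspace (spectrum P). h T \<in> elem_set Q d}"
      by (rule spectrum_basis)
    then have "(d, p) \<in> inclusion_refiner P Q h"
      using dF minimal_selector_Field[OF S p(1)] by (auto simp: inclusion_refiner_def)
    then show "S \<inter> C \<noteq> {}"
      using p(1) d(1) minimal_selector_Field[OF S p(1)] by (auto simp: C_def)
  qed (simp add: C_def)
  then show "\<exists>C. cap P C \<and> (\<forall>c\<in>C. \<exists>d\<in>D. (d, c) \<in> inclusion_refiner P Q h)"
    by (intro exI[of _ C]) (auto simp: C_def)
qed

lemma wedge_preserving_inclusion_refiner:
  assumes "regular_prime_omega P" "regular_prime_omega Q"
  shows "wedge_preserving P Q (inclusion_refiner P Q h)"
  unfolding wedge_preserving_def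
proof (intro ballI impI)
  interpret P: regular_prime_omega P by fact
  interpret Q: regular_prime_omega Q by fact
  fix p p' q q'
  assume F: "p \<in> Field P" "p' \<in> Field P" "q \<in> Field Q" "q' \<in> Field Q"
    and *: "(q, p) \<in> inclusion_refiner P Q h \<and> (q', p') \<in> inclusion_refiner P Q h \<and> wedge P p p'"
  then obtain S where "minimal_selector P S" "p \<in> S" "p' \<in> S"
    using P.wedge_iff_common_selector[OF F(1,2)] by blast
  then have "S \<in> elem_set P p" "S \<in> elem_set P p'" by (simp_all add: mem_elem_set)
  then have "h S \<in> elem_set Q q" "h S \<in> elem_set Q q'" using * by (auto simp: inclusion_refiner_def)
  then show "wedge Q q q'" using Q.wedge_iff_common_selector[OF F(3,4)] by (auto simp: mem_elem_set)
qed

lemma spectrum_map_inclusion_refiner: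
  assumes P: "regular_prime_omega P" and Q: "regular_prime_omega Q"
    and h: "continuous_map (spectrum P) (spectrum Q) h" and ext: "h \<in> extensional (spectrum_set P)"
  shows "spectrum_map P Q (inclusion_refiner P Q h) = h"
proof
  fix S
  let ?\<rho> = "inclusion_refiner P Q h"
  show "spectrum_map P Q ?\<rho> S = h S"
  proof (cases "minimal_selector P S")
    case True
    have \<rho>: "refiner P Q ?\<rho>" "wedge_preserving P Q ?\<rho>"
      using refiner_inclusion_refiner[OF _ h] wedge_preserving_inclusion_refiner[OF P Q] P
      by (simp_all add: regular_prime_omega_def omega_def)
    have hS: "minimal_selector Q (h S)"
      using continuous_map_image_subset_topspace[OF h] True
      by (auto simp: mem_spectrum_set[symmetric])
    have "?\<rho>\<inverse> `` S \<subseteq> h S"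
      using True by (auto simp: inclusion_refiner_def mem_elem_set image_subset_iff)
    then have "spectrum_map P Q ?\<rho> S \<subseteq> h S"
      using spectrum_map_minimal_selector(2)[OF P Q \<rho> True] by blast
    then show ?thesis
      using minimal_selector_eqI[OF hS] minimal_selector_selector
        spectrum_map_minimal_selector(1)[OF P Q \<rho> True] by metis
  next
    case False
    then show ?thesis using ext by (simp add: spectrum_map_def mem_spectrum_set extensional_def)
  qed
qed

theorem spectrum_full:
  "full_functor (poset_category :: ('a rel, 'a rel) category) compact_metrizable_category spectrum spectrum_map"
  unfolding full_functor_def
proof (intro conjI ballI spectrum_functor)
  fix P Q :: "'a rel" and h
  assume "P \<in> Obj poset_category" "Q \<in> Obj poset_category"
    and "h \<in> Hom compact_metrizable_category (spectrum P) (spectrum Q)"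
  then have P: "regular_prime_omega P" and Q: "regular_prime_omega Q"
    and h: "continuous_map (spectrum P) (spectrum Q) h" "h \<in> extensional (spectrum_set P)"
    by (simp_all add: Obj_poset_category compact_metrizable_category_def)
  have "omega_poset P" using P by (simp add: regular_prime_omega_def omega_def)
  then have "inclusion_refiner P Q h \<in> Hom poset_category P Q"
    unfolding Hom_poset_category
    using refiner_inclusion_refiner[OF _ h(1)] wedge_preserving_inclusion_refiner[OF P Q] by blast
  with spectrum_map_inclusion_refiner[OF P Q h]
  show "\<exists>\<rho>\<in>Hom poset_category P Q. spectrum_map P Q \<rho> = h" by blast
qed


section \<open>Every compact metric space is a spectrum\<close>

text \<open>
  The elements of \<open>E\<close> name balls: \<open>a\<close> stands for the ball of radius \<open>2\<^sup>-\<^sup>k\<close> around \<open>ctr a\<close>, where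
  \<open>k = lev a\<close>, and the centres at level \<open>n\<close> form a finite \<open>2\<^sup>-\<^sup>n/2\<close>-net. Naming the balls by an abstract
  set \<open>E\<close> lets the poset be built directly on any infinite type. Distinct names may denote the same
  ball. The factor \<open>1/2\<close> in the net leaves room for the radius of a deeper ball, which is
  at most \<open>2\<^sup>-\<^sup>n/2\<close>.
\<close>

locale ball_poset = Metric_space X d
  for X :: "'x set" and d :: "'x \<Rightarrow> 'x \<Rightarrow> real" +
  fixes E :: "'a set" and lev :: "'a \<Rightarrow> nat" and ctr :: "'a \<Rightarrow> 'x"
  assumes compact: "compact_space mtopology"
    and finite_lev: "finite {a \<in> E. lev a = n}"
    and ctr_in: "a \<in> E \<Longrightarrow> ctr a \<in> X"
    and dense: "x \<in> X \<Longrightarrow> \<exists>a\<in>E. lev a = n \<and> d x (ctr a) < (1/2)^n / 2"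
begin

definition rad :: "'a \<Rightarrow> real" where
  "rad a = (1/2) ^ lev a"

text \<open>
  The strict order of formal balls. It implies inclusion of the balls. Inclusion itself would not do,
  because balls of different radii can coincide as sets; here the radius strictly decreases.
\<close>

definition below :: "'a \<Rightarrow> 'a \<Rightarrow> bool" where
  "below a b \<longleftrightarrow> d (ctr a) (ctr b) + rad a < rad b"

definition ball_order :: "'a rel" where
  "ball_order = {(a, b). a \<in> E \<and> b \<in> E \<and> (a = b \<or> below a b)}"

definition nbhds :: "'x \<Rightarrow> 'a set" where
  "nbhds x = {a \<in> E. d x (ctr a) < rad a}"

definition layer :: "nat \<Rightarrow> 'a set" where
  "layer n = {a \<in> E. lev a = n}"

lemma rad_pos: "0 < rad a"
  by (simp add: rad_def)

lemma rad_layer: "a \<in> layer n \<Longrightarrow> rad a = (1/2)^n"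
  by (simp add: layer_def rad_def)

lemma below_lev: "below a b \<Longrightarrow> lev b < lev a"
proof (rule ccontr)
  assume *: "below a b" "\<not> lev b < lev a"
  then have "(1/2::real) ^ lev b \<le> (1/2) ^ lev a" by (intro power_decreasing) auto
  with * nonneg[of "ctr a" "ctr b"] show False by (simp add: below_def rad_def)
qed

lemma below_trans:
  assumes "below a b" "below b c" "a \<in> E" "b \<in> E" "c \<in> E" shows "below a c"
  using triangle[of "ctr a" "ctr b" "ctr c"] assms ctr_in by (simp add: below_def)

lemma Field_ball_order: "Field ball_order = E"
  by (auto simp: ball_order_def Field_def)

lemma ball_order_trans: "(a, b) \<in> ball_order \<Longrightarrow> (b, c) \<in> ball_order \<Longrightarrow> (a, c) \<in> ball_order"
  unfolding ball_order_def using below_trans by blast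

lemma Partial_order_ball_order: "Partial_order ball_order"
  unfolding partial_order_on_def preorder_on_def
proof (intro conjI)
  show "refl_on (Field ball_order) ball_order" unfolding Field_ball_order by (auto simp: refl_on_def ball_order_def)
  show "trans ball_order" using ball_order_trans by (auto intro: transI)
  show "antisym ball_order"
    by (rule antisymI) (auto simp: ball_order_def dest!: below_lev)
qed (auto simp: Field_def)

lemma half_power_le: "m < n \<Longrightarrow> (1/2::real)^n \<le> (1/2)^m / 2"
  using power_decreasing[of "Suc m" n "1/2::real"] by simp

lemma layer_below:
  assumes "a \<in> E" "n < lev a" shows "\<exists>b\<in>layer n. below a b"
proof -
  obtain b where b: "b \<in> E" "lev b = n" "d (ctr a) (ctr b) < (1/2)^n / 2"
    using dense[of "ctr a" n] ctr_in assms by blast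
  have "rad a \<le> (1/2)^n / 2" using half_power_le[OF assms(2)] by (simp add: rad_def)
  with b show ?thesis by (auto simp: layer_def below_def rad_def)
qed

lemma layer_above:
  assumes "b \<in> E" "lev b < n" shows "\<exists>a\<in>layer n. below a b"
proof -
  obtain a where a: "a \<in> E" "lev a = n" "d (ctr b) (ctr a) < (1/2)^n / 2"
    using dense[of "ctr b" n] ctr_in assms by blast
  have "(1/2)^n \<le> rad b / 2" using half_power_le[OF assms(2)] by (simp add: rad_def)
  moreover have "(0::real) < (1/2)^n" by simp
  ultimately have "d (ctr a) (ctr b) + (1/2)^n < rad b"
    using a(3) commute[of "ctr a" "ctr b"] by linarith
  then show ?thesis using a by (auto simp: layer_def below_def rad_def)
qed

lemma finite_layer: "finite (layer n)"
  unfolding layer_def by (rule finite_lev)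

lemma band_layer: "band ball_order (layer n)"
  unfolding band_def Field_ball_order
proof (intro conjI ballI finite_layer)
  show "layer n \<subseteq> E" by (auto simp: layer_def)
  fix p assume p: "p \<in> E"
  consider "lev p = n" | "n < lev p" | "lev p < n" by linarith
  then show "\<exists>b\<in>layer n. (p, b) \<in> ball_order \<or> (b, p) \<in> ball_order"
  proof cases
    case 1
    then show ?thesis using p by (auto simp: layer_def ball_order_def)
  next
    case 2
    then show ?thesis using layer_below[OF p] p by (auto simp: layer_def ball_order_def)
  next
    case 3
    then show ?thesis using layer_above[OF p] p by (auto simp: layer_def ball_order_def)
  qed
qed

text \<open>
  A layer deeper than all elements of a finite band refines it, since elements comparable to deeper ones
  lie above them.
\<close>

lemma cap_ball_order: "cap ball_order C \<longleftrightarrow> C \<subseteq> E \<and> (\<exists>n. refines ball_order (layer n) C)"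
proof
  assume "cap ball_order C"
  then obtain B where B: "band ball_order B" "refines ball_order B C" and C: "C \<subseteq> E"
    by (auto simp: cap_def Field_ball_order)
  define n where "n = Suc (Max (lev ` B))"
  have "refines ball_order (layer n) C"
    unfolding refines_def
  proof
    fix l assume l: "l \<in> layer n"
    then have "l \<in> Field ball_order" by (simp add: Field_ball_order layer_def)
    then obtain b where b: "b \<in> B" "(l, b) \<in> ball_order \<or> (b, l) \<in> ball_order" using B(1) unfolding band_def by blast
    have "lev b \<le> Max (lev ` B)" using b(1) B(1) by (simp add: band_def)
    then have "lev b < lev l" using l by (simp add: layer_def n_def)
    then have "(l, b) \<in> ball_order" using b(2) below_lev by (force simp: ball_order_def)
    then show "\<exists>t\<in>C. (l, t) \<in> ball_order" using b(1) B(2) ball_order_trans unfolding refines_def by blast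
  qed
  then show "C \<subseteq> E \<and> (\<exists>n. refines ball_order (layer n) C)" using C by blast
next
  assume "C \<subseteq> E \<and> (\<exists>n. refines ball_order (layer n) C)"
  then show "cap ball_order C" unfolding cap_def Field_ball_order using band_layer by blast
qed

lemma cap_layer: "cap ball_order (layer n)"
  unfolding cap_ball_order by (auto simp: refines_def layer_def ball_order_def intro!: exI[of _ n])

text \<open>
  An element at level \<open>k\<close> lies below elements of all \<open>k\<close> earlier layers. So a bound on the size of its
  principal filter bounds its level, and layers are finite.
\<close>

lemma omega_poset_ball_order: "omega_poset ball_order"
  unfolding omega_poset_def Field_ball_order
proof (intro conjI ballI allI Partial_order_ball_order[unfolded Field_ball_order])
  have fin: "finite {a \<in> E. lev a \<le> n}" for n
  proof -
    have "{a \<in> E. lev a \<le> n} = (\<Union>k\<le>n. layer k)" by (auto simp: layer_def)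
    then show ?thesis using finite_layer by simp
  qed
  show finite_above: "finite (above ball_order a)" if "a \<in> E" for a
    by (rule finite_subset[OF _ fin[of "lev a"]]) (use below_lev in \<open>fastforce simp: above_def ball_order_def\<close>)
  fix n
  have card: "lev a \<le> card (above ball_order a)" if a: "a \<in> E" for a
  proof -
    have "\<exists>b\<in>above ball_order a. lev b = k" if k: "k < lev a" for k
      using layer_below[OF a k] a by (auto simp: above_def ball_order_def layer_def)
    then have "{..<lev a} \<subseteq> lev ` above ball_order a" by force
    then have "card {..<lev a} \<le> card (lev ` above ball_order a)"
      using finite_above[OF a] by (intro card_mono) auto
    also have "\<dots> \<le> card (above ball_order a)" using finite_above[OF a] by (rule card_image_le)
    finally show ?thesis by simp
  qed
  have "{F \<in> above ball_order ` E. card F = n} \<subseteq> above ball_order ` {a \<in> E. lev a \<le> n}" using card by auto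
  then show "finite {F \<in> above ball_order ` E. card F = n}" using fin by (meson finite_imageI finite_subset)
qed

lemma ball_order_nbhds:
  assumes "(a, b) \<in> ball_order" "a \<in> nbhds x" "x \<in> X" shows "b \<in> nbhds x"
  using assms triangle[of x "ctr a" "ctr b"] ctr_in
  by (auto simp: ball_order_def nbhds_def below_def)

lemma nbhds_layer: "x \<in> X \<Longrightarrow> \<exists>a\<in>layer n. a \<in> nbhds x"
proof -
  assume "x \<in> X"
  then obtain a where a: "a \<in> E" "lev a = n" "d x (ctr a) < (1/2)^n / 2" using dense by blast
  moreover have "(0::real) < (1/2)^n" by simp
  ultimately have "d x (ctr a) < (1/2)^n" by linarith
  with a show ?thesis by (auto simp: layer_def nbhds_def rad_def)
qed

lemma selector_nbhds:
  assumes x: "x \<in> X" shows "selector ball_order (nbhds x)"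
  unfolding selector_def Field_ball_order
proof (intro conjI allI impI)
  show "nbhds x \<subseteq> E" by (auto simp: nbhds_def)
  fix C assume "cap ball_order C"
  then obtain n where n: "refines ball_order (layer n) C" by (auto simp: cap_ball_order)
  obtain a where "a \<in> layer n" "a \<in> nbhds x" using nbhds_layer[OF x] by blast
  with n ball_order_nbhds[OF _ _ x] show "nbhds x \<inter> C \<noteq> {}" unfolding refines_def by blast
qed

lemma exists_half_power_less: "0 < e \<Longrightarrow> \<exists>n. (1/2::real)^n < e"
  using real_arch_pow_inv[of e "1/2"] by auto

text \<open>
  Otherwise every point lies in a ball missing from \<open>T\<close>. Half the margin by which it does so gives a
  cover; finitely many of these half-margins suffice, and a layer of radius below all of them refines the
  missing balls. These then form a cap that avoids \<open>T\<close>.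
\<close>

lemma selector_contains_nbhds:
  assumes T: "selector ball_order T"
  obtains x where "x \<in> X" "nbhds x \<subseteq> T"
proof (rule ccontr)
  assume "\<not> thesis"
  then have "\<forall>x\<in>X. \<exists>a\<in>E. a \<notin> T \<and> d x (ctr a) < rad a" using that by (auto simp: nbhds_def)
  then obtain f where f: "\<And>x. x \<in> X \<Longrightarrow> f x \<in> E \<and> f x \<notin> T \<and> d x (ctr (f x)) < rad (f x)" by metis
  \<comment> \<open>One half of the margin is spent on the distance from \<open>x\<close>, the other on the radius of the small ball.\<close>
  define r where "r x = (rad (f x) - d x (ctr (f x))) / 2" for x
  have r: "0 < r x" if "x \<in> X" for x using f[OF that] by (simp add: r_def)
  let ?U = "(\<lambda>x. mball x (r x)) ` X"
  have "X \<subseteq> \<Union>?U" using r by force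
  then have "(\<forall>U\<in>?U. openin mtopology U) \<and> topspace mtopology \<subseteq> \<Union>?U" by auto
  from compact[unfolded compact_space_alt, THEN spec, THEN mp, OF this]
  obtain \<F> where \<F>: "finite \<F>" "\<F> \<subseteq> ?U" "X \<subseteq> \<Union>\<F>" by auto
  from finite_subset_image[OF \<F>(1,2)] obtain K where K: "K \<subseteq> X" "finite K" "\<F> = (\<lambda>x. mball x (r x)) ` K"
    by blast
  with \<F>(3) have cover: "X \<subseteq> (\<Union>x\<in>K. mball x (r x))" by simp
  obtain n where n: "\<And>x. x \<in> K \<Longrightarrow> (1/2)^n < r x"
  proof -
    have "\<exists>n. (1/2)^n < Min (insert 1 (r ` K))"
      using K r by (intro exists_half_power_less) auto
    then show ?thesis using K(2) that by auto
  qed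
  have "refines ball_order (layer n) (E - T)"
    unfolding refines_def
  proof
    fix a assume a: "a \<in> layer n"
    then have aE: "a \<in> E" by (simp add: layer_def)
    then obtain x where x: "x \<in> K" "d x (ctr a) < r x" using cover ctr_in[OF aE] by auto
    have xX: "x \<in> X" using x K(1) by blast
    have "d (ctr a) (ctr (f x)) \<le> d x (ctr a) + d x (ctr (f x))"
      using triangle[of "ctr a" x "ctr (f x)"] commute[of "ctr a" x] xX ctr_in[OF aE] ctr_in f[OF xX] by simp
    then have "below a (f x)"
      using x n[OF x(1)] rad_layer[OF a] by (simp add: below_def r_def)
    then show "\<exists>t\<in>E - T. (a, t) \<in> ball_order" using f[OF xX] aE by (intro bexI[of _ "f x"]) (auto simp: ball_order_def)
  qed
  then have "cap ball_order (E - T)" by (auto simp: cap_ball_order)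
  from selector_meets_cap[OF T this] show False by blast
qed

text \<open>
  Given a ball \<open>b\<close> containing \<open>x\<close>, all sufficiently small balls containing \<open>x\<close> are below \<open>b\<close>. So \<open>b\<close> together with
  the balls of a deep layer that do not contain \<open>x\<close> is a cap, and a selector inside \<open>nbhds x\<close> can meet it only in
  \<open>b\<close>.
\<close>

lemma minimal_selector_nbhds:
  assumes x: "x \<in> X" shows "minimal_selector ball_order (nbhds x)"
  unfolding minimal_selector_def
proof (intro conjI allI impI selector_nbhds[OF x])
  fix T assume T: "selector ball_order T \<and> T \<subseteq> nbhds x"
  have "b \<in> T" if b: "b \<in> nbhds x" for b
  proof -
    have bE: "b \<in> E" using b by (simp add: nbhds_def)
    \<comment> \<open>The slack is halved: a small ball costs at most its radius twice, for its distance from \<open>x\<close> and its size.\<close>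
    have "0 < (rad b - d x (ctr b)) / 2" using b by (simp add: nbhds_def)
    from exists_half_power_less[OF this] obtain n where n: "(1/2)^n < (rad b - d x (ctr b)) / 2" ..
    define C where "C = insert b (layer n - nbhds x)"
    have "refines ball_order (layer n) C"
      unfolding refines_def
    proof
      fix a assume a: "a \<in> layer n"
      then have aE: "a \<in> E" by (simp add: layer_def)
      show "\<exists>t\<in>C. (a, t) \<in> ball_order"
      proof (cases "a \<in> nbhds x")
        case True
        have "d (ctr a) (ctr b) \<le> d x (ctr a) + d x (ctr b)"
          using triangle[of "ctr a" x "ctr b"] commute[of "ctr a" x] x ctr_in aE bE by simp
        then have "below a b" using n rad_layer[OF a] True by (simp add: below_def nbhds_def)
        then show ?thesis using aE bE by (auto simp: C_def ball_order_def)
      next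
        case False
        then show ?thesis using a aE by (auto simp: C_def ball_order_def)
      qed
    qed
    then have "cap ball_order C" using bE by (auto simp: cap_ball_order C_def layer_def)
    then obtain c where "c \<in> C" "c \<in> T" using selector_meets_cap T by blast
    then show ?thesis using T by (auto simp: C_def)
  qed
  then show "T = nbhds x" using T by blast
qed

lemma spectrum_set_ball_order: "spectrum_set ball_order = nbhds ` X"
proof (intro equalityI subsetI)
  fix S assume "S \<in> spectrum_set ball_order"
  then have S: "minimal_selector ball_order S" by (simp add: mem_spectrum_set)
  obtain x where "x \<in> X" "nbhds x \<subseteq> S"
    using selector_contains_nbhds[OF minimal_selector_selector[OF S]] .
  with minimal_selector_eqI[OF S selector_nbhds] show "S \<in> nbhds ` X" by blast
qed (auto simp: mem_spectrum_set minimal_selector_nbhds)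

lemma prime_poset_ball_order: "prime_poset ball_order"
  unfolding prime_poset_def Field_ball_order
proof
  fix a assume a: "a \<in> E"
  then have "a \<in> nbhds (ctr a)" using rad_pos ctr_in by (simp add: nbhds_def)
  with minimal_selector_nbhds[OF ctr_in[OF a]] show "\<exists>S. minimal_selector ball_order S \<and> a \<in> S" by blast
qed

text \<open>
  If \<open>d(ctr a, ctr b) + rad a < rad b\<close>, then any ball that meets \<open>a\<close> and has radius less than half of the slack
  is below \<open>b\<close>. So a deep layer witnesses \<open>a \<triangleleft> b\<close>.
\<close>

lemma below_imp_star_below:
  assumes E: "a \<in> E" "b \<in> E" and "below a b" shows "star_below ball_order a b"
proof -
  define \<delta> where "\<delta> = rad b - rad a - d (ctr a) (ctr b)"
  have "0 < \<delta> / 2" using \<open>below a b\<close> by (simp add: \<delta>_def below_def)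
  from exists_half_power_less[OF this] obtain n where n: "(1/2)^n < \<delta> / 2" ..
  have "(c, b) \<in> ball_order" if c: "c \<in> layer n" "wedge ball_order c a" for c
  proof -
    have cE: "c \<in> E" using c by (simp add: layer_def)
    obtain w where w: "w \<in> E" "(w, c) \<in> ball_order" "(w, a) \<in> ball_order" using c(2) by (auto simp: wedge_def Field_ball_order)
    have "w \<in> nbhds (ctr w)" using rad_pos ctr_in w by (simp add: nbhds_def)
    then have "c \<in> nbhds (ctr w)" "a \<in> nbhds (ctr w)" using w ball_order_nbhds ctr_in by blast+
    then have "d (ctr w) (ctr c) < rad c" "d (ctr w) (ctr a) < rad a" by (simp_all add: nbhds_def)
    moreover have "d (ctr c) (ctr b) \<le> d (ctr w) (ctr c) + d (ctr w) (ctr a) + d (ctr a) (ctr b)"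
      using triangle[of "ctr c" "ctr w" "ctr b"] triangle[of "ctr w" "ctr a" "ctr b"]
        commute[of "ctr c" "ctr w"] ctr_in w cE E by simp
    ultimately have "below c b" using n rad_layer[OF c(1)] by (simp add: below_def \<delta>_def)
    then show ?thesis using cE E by (simp add: ball_order_def)
  qed
  then show ?thesis
    unfolding star_below_def Field_ball_order using E cap_layer by (auto simp: star_in_def intro!: exI[of _ "layer n"])
qed

lemma regular_poset_ball_order: "regular_poset ball_order"
  unfolding regular_poset_def
proof (intro allI impI)
  fix D assume D: "cap ball_order D"
  then obtain n where n: "refines ball_order (layer n) D" and DE: "D \<subseteq> E" by (auto simp: cap_ball_order)
  have "\<exists>d\<in>D. star_below ball_order c d" if c: "c \<in> layer (Suc n)" for c
  proof -
    have cE: "c \<in> E" using c by (simp add: layer_def)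
    obtain b where b: "b \<in> layer n" "below c b" using layer_below[of c n] c by (auto simp: layer_def)
    obtain e where e: "e \<in> D" "(b, e) \<in> ball_order" using n b(1) by (auto simp: refines_def)
    have "below c e" using e(2) b(2) below_trans[of c b e] cE by (auto simp: ball_order_def)
    then show ?thesis using below_imp_star_below[OF cE] e(1) DE by blast
  qed
  then show "\<exists>C. cap ball_order C \<and> (\<forall>c\<in>C. \<exists>d\<in>D. star_below ball_order c d)" using cap_layer by blast
qed

lemma regular_prime_omega_ball_order: "regular_prime_omega ball_order"
  by (intro regular_prime_omega.intro omega.intro regular_prime_omega_axioms.intro
      omega_poset_ball_order prime_poset_ball_order regular_poset_ball_order)

lemma nbhds_inj: "inj_on nbhds X"
proof (rule inj_onI, rule ccontr)
  fix x y assume xy: "x \<in> X" "y \<in> X" "nbhds x = nbhds y" "x \<noteq> y"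
  then have "0 < d x y / 2" by simp
  from exists_half_power_less[OF this] obtain n where n: "(1/2)^n < d x y / 2" ..
  obtain a where a: "a \<in> layer n" "a \<in> nbhds x" using nbhds_layer[OF xy(1)] by blast
  then have "a \<in> nbhds y" using xy(3) by simp
  with a have "d x (ctr a) < (1/2)^n" "d y (ctr a) < (1/2)^n" "ctr a \<in> X"
    using rad_layer[OF a(1)] ctr_in by (simp_all add: nbhds_def)
  then show False
    using triangle[of x "ctr a" y] n xy(1,2) commute[of y "ctr a"] by simp
qed

text \<open>
  The preimage of a basic open set is a ball, so \<open>nbhds\<close> is a continuous bijection from a compact space
  onto a Hausdorff one.
\<close>

lemma homeomorphic_map_nbhds: "homeomorphic_map mtopology (spectrum ball_order) nbhds"
proof (rule continuous_imp_homeomorphic_map)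
  interpret R: regular_prime_omega ball_order by (rule regular_prime_omega_ball_order)
  show "continuous_map mtopology (spectrum ball_order) nbhds"
    unfolding spectrum_def continuous_on_generated_topo_iff topspace_mtopology
  proof (intro conjI allI impI)
    fix U assume "U \<in> insert (spectrum_set ball_order) (elem_set ball_order ` Field ball_order)"
    then consider "U = spectrum_set ball_order" | a where "a \<in> E" "U = elem_set ball_order a" by (auto simp: Field_ball_order)
    then show "openin mtopology (nbhds -` U \<inter> X)"
    proof cases
      case 1
      then have "nbhds -` U \<inter> X = X" by (auto simp: spectrum_set_ball_order)
      then show ?thesis by (metis openin_topspace topspace_mtopology)
    next
      case 2
      then have "nbhds -` U \<inter> X = mball (ctr a) (rad a)"
        using ctr_in by (auto simp: elem_set_def spectrum_set_ball_order nbhds_def commute)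
      then show ?thesis by simp
    qed
  next
    show "nbhds ` X \<subseteq> \<Union>(insert (spectrum_set ball_order) (elem_set ball_order ` Field ball_order))"
      by (auto simp: spectrum_set_ball_order)
  qed
  show "Hausdorff_space (spectrum ball_order)" by (rule R.Hausdorff_space_spectrum)
qed (use compact nbhds_inj spectrum_set_ball_order in auto)

end

text \<open>
  The pairs \<open>(n, x)\<close> with \<open>x\<close> in the \<open>n\<close>-th net form a countable set, which is injected into the infinite
  type to serve as the names of the balls.
\<close>

lemma compact_metrizable_is_spectrum:
  fixes X :: "'x topology"
  assumes inf: "infinite (UNIV :: 'a set)" and "compact_space X" "metrizable_space X"
  shows "\<exists>P \<in> Obj (poset_category :: ('a rel, 'a rel) category). spectrum P homeomorphic_space X"
proof -
  obtain M d where M: "Metric_space M d" and X: "X = Metric_space.mtopology M d"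
    using assms(3) by (auto simp: metrizable_space_def)
  interpret Metric_space M d by (rule M)
  have "mtotally_bounded M" using assms(2) compact_space_eq_mcomplete_mtotally_bounded X by blast
  then have "\<forall>n::nat. \<exists>K. finite K \<and> K \<subseteq> M \<and> M \<subseteq> (\<Union>x\<in>K. mball x ((1/2)^n / 2))"
    by (simp add: mtotally_bounded_def)
  then obtain K where K: "\<And>n::nat. finite (K n)" "\<And>n. K n \<subseteq> M"
    "\<And>n. M \<subseteq> (\<Union>x\<in>K n. mball x ((1/2)^n / 2))" by metis
  define N where "N = (SIGMA n:UNIV. K n)"
  have "countable N" unfolding N_def using K(1) by (intro countable_SIGMA) (auto intro: countable_finite)
  obtain g :: "nat \<Rightarrow> 'a" where "inj g" using inf infinite_countable_subset by blast
  define h where "h = g \<circ> to_nat_on N"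
  have h: "inj_on h N"
    unfolding h_def using \<open>countable N\<close> \<open>inj g\<close>
    by (intro comp_inj_on inj_on_to_nat_on) (auto intro: inj_on_subset)
  define v where "v = inv_into N h"
  have v: "v (h p) = p" if "p \<in> N" for p using h that by (simp add: v_def)
  interpret B: ball_poset M d "h ` N" "fst \<circ> v" "snd \<circ> v"
  proof (intro ball_poset.intro ball_poset_axioms.intro M)
    show "compact_space mtopology" using assms(2) X by simp
    fix n
    have "{a \<in> h ` N. (fst \<circ> v) a = n} \<subseteq> h ` ({n} \<times> K n)" by (auto simp: v N_def)
    then show "finite {a \<in> h ` N. (fst \<circ> v) a = n}" using K(1) by (meson finite_SigmaI finite.emptyI finite_imageI finite_insert finite_subset)
    fix x assume "x \<in> M"
    then obtain y where y: "y \<in> K n" "d x y < (1/2)^n / 2" using K(3)[of n] commute by fastforce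
    then have "(n, y) \<in> N" by (simp add: N_def)
    with y show "\<exists>a\<in>h ` N. (fst \<circ> v) a = n \<and> d x ((snd \<circ> v) a) < (1/2)^n / 2"
      by (intro bexI[of _ "h (n, y)"]) (auto simp: v)
  next
    fix a assume "a \<in> h ` N"
    then show "(snd \<circ> v) a \<in> M" using K(2) by (auto simp: v) (auto simp: N_def)
  qed
  have "X homeomorphic_space spectrum B.ball_order"
    using B.homeomorphic_map_nbhds X homeomorphic_map_imp_homeomorphic_space by blast
  then show ?thesis
    using B.regular_prime_omega_ball_order Obj_poset_category homeomorphic_space_sym by blast
qed

section \<open>The spectrum functor is essentially surjective and full\<close>

lemma homeomorphic_imp_isomorphic_objects:
  assumes "X homeomorphic_space Y"
  shows "isomorphic_objects compact_metrizable_category X Y"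
proof -
  obtain f g where fg: "homeomorphic_maps X Y f g" using assms by (auto simp: homeomorphic_space_def)
  define f' where "f' = restrict f (topspace X)"
  define g' where "g' = restrict g (topspace Y)"
  have f: "continuous_map X Y f" and g: "continuous_map Y X g"
    and gf: "\<And>x. x \<in> topspace X \<Longrightarrow> g (f x) = x" and fg: "\<And>y. y \<in> topspace Y \<Longrightarrow> f (g y) = y"
    using fg by (auto simp: homeomorphic_maps_def)
  have fX: "f x \<in> topspace Y" if "x \<in> topspace X" for x
    using continuous_map_image_subset_topspace[OF f] that by blast
  have gY: "g y \<in> topspace X" if "y \<in> topspace Y" for y
    using continuous_map_image_subset_topspace[OF g] that by blast
  have "continuous_map X Y f'" by (rule continuous_map_eq[OF f]) (simp add: f'_def)
  moreover have "continuous_map Y X g'" by (rule continuous_map_eq[OF g]) (simp add: g'_def)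
  moreover have "compose (topspace X) g' f' = (\<lambda>x\<in>topspace X. x)" "compose (topspace Y) f' g' = (\<lambda>y\<in>topspace Y. y)"
    using fX gY gf fg by (auto simp: compose_def f'_def g'_def restrict_def fun_eq_iff)
  ultimately show ?thesis
    unfolding isomorphic_objects_def compact_metrizable_category_def
    by (intro bexI[of _ f'] bexI[of _ g']) (auto simp: f'_def g'_def)
qed

theorem theorem3p4:
  assumes "infinite (UNIV :: 'a set)"
  shows "is_functor (poset_category :: ('a rel, 'a rel) category) compact_metrizable_category
           spectrum spectrum_map \<and>
         full_functor (poset_category :: ('a rel, 'a rel) category) compact_metrizable_category
           spectrum spectrum_map \<and>
         essentially_surjective_functor (poset_category :: ('a rel, 'a rel) category)
           compact_metrizable_category spectrum spectrum_map \<and>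
         (\<forall>X :: 'x topology. compact_space X \<and> metrizable_space X \<longrightarrow>
           (\<exists>P \<in> Obj (poset_category :: ('a rel, 'a rel) category).
              spectrum P homeomorphic_space X))"
proof (intro conjI allI impI spectrum_functor spectrum_full)
  show "essentially_surjective_functor (poset_category :: ('a rel, 'a rel) category)
           compact_metrizable_category spectrum spectrum_map"
    unfolding essentially_surjective_functor_def
  proof (intro conjI ballI spectrum_functor)
    fix Z :: "'a set topology" assume "Z \<in> Obj compact_metrizable_category"
    then have "compact_space Z" "metrizable_space Z" by (simp_all add: compact_metrizable_category_def)
    from compact_metrizable_is_spectrum[OF assms this]
    show "\<exists>P\<in>Obj (poset_category :: ('a rel, 'a rel) category).
        isomorphic_objects compact_metrizable_category (spectrum P) Z"
      using homeomorphic_imp_isomorphic_objects by blast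
  qed
qed (use compact_metrizable_is_spectrum[OF assms] in blast)

end
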